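(* There is a universal constant $c_0>0$ such that the following holds. Let $X$ be a nonempty compact connected metric space, regarded as a subset of $\ell^\infty$ via an isometric embedding, and suppose there are $\beta>0$ and $r_0>0$ such that $\beta'_X(x,r)>\beta$ for all $x\in X$ and all $r\in(0,r_0)$. Then the Hausdorff dimension of $X$ satisfies $\dim X\ge 1+c_0\beta^2$.
   Context: Every compact metric space embeds isometrically in $\ell^\infty=\ell^\infty(\mathbb{N})$ (Kuratowski embedding), and all compact metric spaces are implicitly regarded as subsets of $\ell^\infty$. Write $|\cdot|$ for the norm of $\ell^\infty$, $B(x,r)=\{y\in\ell^\infty:|x-y|<r\}$, and $\mathrm{dist}(z,A)=\inf_{a\in A}|z-a|$. For $X\subseteq\ell^\infty$, $x\in X$ and $r>0$ define $$\beta'_X(x,r)=\inf_s\frac{\ell(s)-|s(0)-s(1)|+\sup_{z\in X\cap B(x,r)}\mathrm{dist}(z,s([0,1]))}{|s(0)-s(1)|},$$ where the infimum is over all curves (continuous maps) $s:[0,1]\to B(x,r)\subseteq\ell^\infty$ with $s(0)\neq s(1)$, and $\ell(s)=\sup\sum_{i=0}^{n-1}|s(t_i)-s(t_{i+1})|$ is the length of $s$, the supremum being over all partitions $0=t_0<t_1<\dots<t_n=1$. *)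

theory Defs
  imports "HOL-Analysis.Analysis"
begin

(* nat carries the discrete topology, so bounded continuous functions on nat are exactly the
   bounded real sequences, and the library norm is the supremum norm. *)
type_synonym linf = "nat \<Rightarrow>\<^sub>C real"

definition curve_length :: "(real \<Rightarrow> 'a::metric_space) \<Rightarrow> ereal" where
  "curve_length s =
     (SUP (n, t) \<in> {(n::nat, t::nat \<Rightarrow> real). t 0 = 0 \<and> t n = 1 \<and> (\<forall>i<n. t i < t (Suc i))}.
        ereal (\<Sum>i<n. dist (s (t i)) (s (t (Suc i)))))"

(* Extended real valued because curves of infinite length are admitted; for these the quotient
   is infinite. *)
definition beta' :: "linf set \<Rightarrow> linf \<Rightarrow> real \<Rightarrow> ereal" where
  "beta' X x r =
     (INF s \<in> {s. path s \<and> path_image s \<subseteq> ball x r \<and> s 0 \<noteq> s 1}.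
        (curve_length s - ereal (norm (s 0 - s 1))
           + (SUP z \<in> X \<inter> ball x r. ereal (infdist z (path_image s))))
        / ereal (norm (s 0 - s 1)))"

(* Library diameter is meaningful only for bounded sets, and 0 powr 0 = 0; the case s = 0
   implements the usual convention diam(U)^0 = 1 for nonempty U. *)
definition diam_pow :: "real \<Rightarrow> 'a::metric_space set \<Rightarrow> ennreal" where
  "diam_pow s U = (if U = {} then 0 else if s = 0 then 1 else ennreal (diameter U powr s))"

definition hausdorff_premeasure :: "real \<Rightarrow> real \<Rightarrow> 'a::metric_space set \<Rightarrow> ennreal" where
  "hausdorff_premeasure s \<delta> E =
     (INF U \<in> {U :: nat \<Rightarrow> 'a set. E \<subseteq> (\<Union>i. U i) \<and> (\<forall>i. bounded (U i) \<and> diameter (U i) \<le> \<delta>)}.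
        \<Sum>i. diam_pow s (U i))"

definition hausdorff_measure :: "real \<Rightarrow> 'a::metric_space set \<Rightarrow> ennreal" where
  "hausdorff_measure s E = (SUP \<delta> \<in> {0<..}. hausdorff_premeasure s \<delta> E)"

definition hausdorff_dim :: "'a::metric_space set \<Rightarrow> ereal" where
  "hausdorff_dim E = (INF s \<in> {s. 0 \<le> s \<and> hausdorff_measure s E = 0}. ereal s)"

end

theory Submission
  imports Defs
begin

text \<open>
A continuum that is nowhere close to a geodesic gains length at every scale, and a set that gains
length at every scale by a definite factor has dimension larger than one. The quantitative form is
as follows. A node is a pair \<open>(F, l)\<close> of a continuum \<open>F \<subseteq> X\<close> and a length \<open>l\<close>
that is the distance of two points of \<open>F\<close> or less; its region is the neighbourhood of \<open>F\<close> in
\<open>X\<close> of radius \<open>\<tau> l\<close>, where \<open>\<tau>\<close> is a small multiple of \<open>\<beta>\<close>. Every node \<open>(E, L)\<close> with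
\<open>L \<le> r0\<close> has finitely many child nodes with regions inside its own region, uniformly separated,
of lengths between \<open>L / M\<close> and \<open>L / 2\<close> where \<open>M\<close> is of the order of \<open>1 / \<beta>\<^sup>3\<close>, and such that the lengths of the children
add up to at least \<open>(1 + \<beta> / 2000) L\<close> (\<open>subcontinua_gaining_length\<close>). Hence the sum of
\<open>l powr (1 + s)\<close> over the children is at least \<open>L powr (1 + s)\<close> as soon as
\<open>M powr s \<le> 1 + \<beta> / 2000\<close>, and this allows \<open>s\<close> of the order of \<open>\<beta> / ln (1 / \<beta>)\<close>, in particular of the
order of \<open>\<beta>\<^sup>2\<close> (\<open>exponent_gain\<close>). An induction over the size of the node then bounds
\<open>\<Sum>i. d i powr (1 + s)\<close> from below for every finite cover by sets of diameters \<open>d i\<close>, because a cover set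
that is small compared with a node meets the region of at most one child
(\<open>cover_sum_ge_of_branching\<close>); no measure has to be constructed.

The gain of length has two sources. Let \<open>a\<close> and \<open>b\<close> be points of \<open>E\<close> at distance at least \<open>L\<close>, and join
them in \<open>E\<close> by chains of steps at most \<open>\<epsilon>\<close>, with \<open>\<epsilon>\<close> far below the lengths that matter. If all these chains are longer than
\<open>(1 + \<beta> / 1000) L\<close>, then the function ``length of the shortest chain from \<open>a\<close>'' varies over a range of
that length, and its level sets cut \<open>E\<close> into pieces of size \<open>\<epsilon>\<close> that are numerous enough
(\<open>packing_of_chain_dist\<close>). Otherwise some chain from \<open>a\<close> to \<open>b\<close> is almost straight. The slabs between
spheres around \<open>a\<close> contain continua near this chain, of total length almost \<open>L\<close>
(\<open>packing_near_chain\<close>). Moreover at least half of the blocks of length \<open>\<tau> L\<close> into which the spheres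
divide the chain have very small excess, and for such a block the polygon through its points is an
admissible competitor in the definition of \<open>\<beta>'\<close>: its length exceeds the distance of its ends by
too little to account for \<open>\<beta>\<close>, so there is a point of \<open>X\<close> near the block at distance comparable to \<open>\<beta>\<close>
times the block from it (\<open>far_point_near_chain\<close>). The continuum of \<open>X\<close> around this point is an
additional child. Together the additional children contribute a multiple of \<open>\<beta> L\<close>, which
outweighs the losses caused by the gaps between the children.

Sharp constants are essential, since the gain is only a factor \<open>1 + c \<beta>\<close>. This is the reason for
measuring children by the distance of two of their points and for cutting along level sets of
1-Lipschitz functions instead of packing balls, which would lose a factor \<open>2\<close>.
\<close>

section \<open>Subcontinua between level sets\<close>

text \<open>
This is boundary bumping for the sublevel set of \<open>k\<close>: the component of \<open>x\<close> in
\<open>{z \<in> E. k z \<le> 0}\<close> meets the frontier of that set relative to \<open>E\<close>, and \<open>k\<close> vanishes there. Taking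
\<open>k\<close> to be a maximum of several functions turns it into a statement about the first wall that the component
hits.
\<close>

lemma subcontinuum_reaching_level:
  fixes E :: "'a::metric_space set" and k :: "'a \<Rightarrow> real"
  assumes "compact E" "connected E" "continuous_on E k"
    and "x \<in> E" "k x \<le> 0" and "y \<in> E" "0 \<le> k y"
  obtains Q q where "compact Q" "connected Q" "Q \<subseteq> E" "x \<in> Q" "\<And>z. z \<in> Q \<Longrightarrow> k z \<le> 0"
    "q \<in> Q" "k q = 0"
proof (cases "\<forall>z\<in>E. k z \<le> 0")
  case True
  then have "k y = 0" using assms by force
  then show ?thesis
    using that[of E y] assms True by auto
next
  case False
  define S where "S = {z \<in> E. k z \<le> 0}"
  define T where "T = top_of_set E"
  define C where "C = connected_component_of_set (subtopology T S) x"
  have SE: "S \<subseteq> E" and xS: "x \<in> S"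
    using assms by (auto simp: S_def)
  have sub: "subtopology T S = top_of_set S"
    using SE by (simp add: T_def subtopology_subtopology inf.absorb2)
  have closS: "closedin T S"
  proof -
    have "closedin (top_of_set E) (E \<inter> k -` {..0})"
      by (rule continuous_closedin_preimage[OF \<open>continuous_on E k\<close> closed_atMost])
    moreover have "E \<inter> k -` {..0} = S" by (auto simp: S_def)
    ultimately show ?thesis by (simp add: T_def)
  qed
  have openS: "openin T {z \<in> E. k z < 0}"
  proof -
    have "openin (top_of_set E) (E \<inter> k -` {..<0})"
      by (rule continuous_openin_preimage_gen[OF \<open>continuous_on E k\<close> open_lessThan])
    moreover have "E \<inter> k -` {..<0} = {z \<in> E. k z < 0}" by auto
    ultimately show ?thesis by (simp add: T_def)
  qed
  have Ccomp: "C \<in> connected_components_of (subtopology T S)"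
    unfolding C_def using xS
    by (simp add: connected_component_in_connected_components_of sub)
  have "C \<inter> T frontier_of S \<noteq> {}"
  proof (rule boundary_bumping_theorem_closed[OF _ _ _ closS _ Ccomp])
    show "connected_space T"
      using \<open>connected E\<close> unfolding T_def by (metis connectedin_def connectedin_iff_connected)
    show "compact_space T"
      using \<open>compact E\<close> by (simp add: T_def compact_space_subtopology)
    show "Hausdorff_space T"
      by (simp add: T_def Hausdorff_space_subtopology)
    show "S \<noteq> topspace T"
      using False by (auto simp: S_def T_def)
  qed
  then obtain q where q: "q \<in> C" "q \<in> T frontier_of S" by blast
  have "k q = 0"
  proof -
    have "q \<in> S"
      using q(2) closS by (meson frontier_of_subset_closedin subsetD)
    moreover have "q \<notin> T interior_of S"
      using q(2) by (simp add: frontier_of_def)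
    moreover have "{z \<in> E. k z < 0} \<subseteq> T interior_of S"
      by (rule interior_of_maximal[OF _ openS]) (auto simp: S_def)
    ultimately show ?thesis by (auto simp: S_def)
  qed
  moreover have "C \<subseteq> S"
    using connected_components_of_subset[OF Ccomp] by (simp add: sub)
  moreover have "connected C"
    using connectedin_connected_components_of[OF Ccomp] by (simp add: sub connectedin_subtopology)
  moreover have "compact C"
  proof -
    have "closedin (top_of_set S) C"
      using closedin_connected_components_of[OF Ccomp] by (simp add: sub)
    moreover have "compact S"
      using closS \<open>compact E\<close> by (simp add: T_def closedin_compact)
    ultimately show ?thesis by (rule closedin_compact[rotated])
  qed
  moreover have "x \<in> C"
    using xS by (simp add: C_def connected_component_of_refl sub)
  ultimately show ?thesis
    using that[of C q] q(1) SE by (auto simp: S_def)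
qed

text \<open>
Bumping from \<open>x\<close> up to the level \<open>v\<close>, and then, inside the continuum so obtained, from
there down to the level \<open>u\<close>.
\<close>

lemma subcontinuum_crossing:
  fixes E :: "'a::metric_space set" and g :: "'a \<Rightarrow> real"
  assumes "compact E" "connected E" "continuous_on E g"
    and "x \<in> E" "g x \<le> u" and "y \<in> E" "v \<le> g y" and "u \<le> v"
  obtains Q p q where "compact Q" "connected Q" "Q \<subseteq> E" "\<And>z. z \<in> Q \<Longrightarrow> u \<le> g z \<and> g z \<le> v"
    "p \<in> Q" "g p = u" "q \<in> Q" "g q = v"
proof -
  have "continuous_on E (\<lambda>z. g z - v)"
    using assms by (intro continuous_intros)
  then obtain A q where A: "compact A" "connected A" "A \<subseteq> E" "x \<in> A" "\<And>z. z \<in> A \<Longrightarrow> g z - v \<le> 0"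
    "q \<in> A" "g q - v = 0"
    by (rule subcontinuum_reaching_level[OF assms(1,2) _ \<open>x \<in> E\<close> _ \<open>y \<in> E\<close>]) (use assms in auto)
  have "continuous_on A (\<lambda>z. u - g z)"
    using assms A(3) by (intro continuous_intros) (auto intro: continuous_on_subset)
  then obtain Q p where Q: "compact Q" "connected Q" "Q \<subseteq> A" "q \<in> Q" "\<And>z. z \<in> Q \<Longrightarrow> u - g z \<le> 0"
    "p \<in> Q" "u - g p = 0"
    by (rule subcontinuum_reaching_level[OF A(1,2) _ \<open>q \<in> A\<close> _ \<open>x \<in> A\<close>]) (use assms A in auto)
  show ?thesis
    by (rule that[of Q p q]) (use Q A in force)+
qed

section \<open>A lower bound for the Hausdorff dimension from a branching rule\<close>

text \<open>
This plays the part of the mass distribution principle. If a cover set of size at least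
\<open>\<sigma> * size n\<close> meets the region of \<open>n\<close>, it pays for \<open>n\<close> alone. Otherwise no cover set meets the regions of
two children, so the children are paid for by disjoint parts of the cover. Since a finite cover by
sets of positive size has a smallest size, and sizes of nodes are halved at each step, the induction ends.
\<close>

lemma cover_sum_ge_of_branching:
  fixes X :: "'a::metric_space set" and region :: "'n \<Rightarrow> 'a set" and size :: "'n \<Rightarrow> real"
  assumes t: "0 < t" and \<sigma>: "0 < \<sigma>" "\<sigma> \<le> 1"
    and pos: "\<And>n. node n \<Longrightarrow> 0 < size n"
    and meets: "\<And>n. node n \<Longrightarrow> region n \<inter> X \<noteq> {}"
    and branching: "\<And>n. node n \<Longrightarrow> \<exists>C. finite C
      \<and> (\<forall>c\<in>C. node c \<and> size c \<le> size n / 2 \<and> region c \<subseteq> region n)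
      \<and> (\<forall>a\<in>C. \<forall>b\<in>C. a \<noteq> b \<longrightarrow> (\<forall>y\<in>region a. \<forall>z\<in>region b. \<sigma> * size n \<le> dist y z))
      \<and> size n powr t \<le> (\<Sum>c\<in>C. size c powr t)"
    and I: "finite I" and cover: "X \<subseteq> (\<Union>i\<in>I. U i)"
    and d: "\<And>i. i \<in> I \<Longrightarrow> 0 < d i" "\<And>i y z. i \<in> I \<Longrightarrow> y \<in> U i \<Longrightarrow> z \<in> U i \<Longrightarrow> dist y z \<le> d i"
    and "node n"
  shows "(\<sigma> * size n) powr t \<le> (\<Sum>i\<in>{i\<in>I. U i \<inter> region n \<noteq> {}}. d i powr t)"
proof -
  have "\<exists>e>0. \<forall>i\<in>I. e \<le> d i"
  proof (cases "I = {}")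
    case False
    then show ?thesis
      using I d(1) by (intro exI[of _ "Min (d ` I)"]) simp
  qed (auto intro: gt_ex)
  then obtain e where e: "0 < e" "\<And>i. i \<in> I \<Longrightarrow> e \<le> d i" by blast
  have main: "size n \<le> 2 ^ k * e \<Longrightarrow> node n \<Longrightarrow>
      (\<sigma> * size n) powr t \<le> (\<Sum>i\<in>{i\<in>I. U i \<inter> region n \<noteq> {}}. d i powr t)" for k n
  proof (induction k arbitrary: n)
    case (0 n)
    obtain y where y: "y \<in> region n" "y \<in> X" using meets[OF 0(2)] by blast
    then obtain i where i: "i \<in> I" "y \<in> U i" using cover by blast
    have "\<sigma> * size n \<le> d i"
    proof -
      have "\<sigma> * size n \<le> size n"
        using \<sigma> pos[OF 0(2)] by simp
      then show ?thesis using 0 e(2)[OF i(1)] by simp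
    qed
    then have "(\<sigma> * size n) powr t \<le> d i powr t"
      using \<sigma> pos[OF 0(2)] t by (intro powr_mono2) auto
    also have "\<dots> \<le> (\<Sum>i\<in>{i\<in>I. U i \<inter> region n \<noteq> {}}. d i powr t)"
      by (rule member_le_sum) (use i y I in auto)
    finally show ?case .
  next
    case (Suc k n)
    let ?J = "\<lambda>n. {i\<in>I. U i \<inter> region n \<noteq> {}}"
    have sz: "0 < size n" by (rule pos[OF Suc(3)])
    show ?case
    proof (cases "\<exists>i\<in>?J n. \<sigma> * size n \<le> d i")
      case True
      then obtain i where i: "i \<in> ?J n" "\<sigma> * size n \<le> d i" by blast
      then have "(\<sigma> * size n) powr t \<le> d i powr t"
        using \<sigma> sz t by (intro powr_mono2) auto
      also have "\<dots> \<le> (\<Sum>i\<in>?J n. d i powr t)"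
        by (rule member_le_sum) (use i I in auto)
      finally show ?thesis .
    next
      case False
      from branching[OF Suc(3)] obtain C where "finite C"
        and C1: "\<forall>c\<in>C. node c \<and> size c \<le> size n / 2 \<and> region c \<subseteq> region n"
        and C2: "\<forall>a\<in>C. \<forall>b\<in>C. a \<noteq> b \<longrightarrow> (\<forall>y\<in>region a. \<forall>z\<in>region b. \<sigma> * size n \<le> dist y z)"
        and C3: "size n powr t \<le> (\<Sum>c\<in>C. size c powr t)"
        by (elim exE conjE)
      have C: "finite C"
        "\<And>c. c \<in> C \<Longrightarrow> node c" "\<And>c. c \<in> C \<Longrightarrow> size c \<le> size n / 2" "\<And>c. c \<in> C \<Longrightarrow> region c \<subseteq> region n"
        "\<And>a b y z. a \<in> C \<Longrightarrow> b \<in> C \<Longrightarrow> a \<noteq> b \<Longrightarrow> y \<in> region a \<Longrightarrow> z \<in> region b \<Longrightarrow> \<sigma> * size n \<le> dist y z"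
        "size n powr t \<le> (\<Sum>c\<in>C. size c powr t)"
        by (rule \<open>finite C\<close>) (use C1 in simp, use C1 in simp, use C1 in simp, use C2 in simp, rule C3)
      have disj: "?J a \<inter> ?J b = {}" if "a \<in> C" "b \<in> C" "a \<noteq> b" for a b
      proof (rule ccontr)
        assume "?J a \<inter> ?J b \<noteq> {}"
        then obtain i y z where i: "i \<in> I" "y \<in> U i" "y \<in> region a" "z \<in> U i" "z \<in> region b" by blast
        then have "\<sigma> * size n \<le> d i"
          using C(5)[OF that i(3,5)] d(2)[OF i(1,2,4)] by linarith
        moreover have "i \<in> ?J n" using i C(4)[OF that(1)] by blast
        ultimately show False using False by blast
      qed
      have "(\<sigma> * size n) powr t = \<sigma> powr t * size n powr t"
        using \<sigma> sz by (simp add: powr_mult)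
      also have "\<dots> \<le> \<sigma> powr t * (\<Sum>c\<in>C. size c powr t)"
        using C(6) by (intro mult_left_mono) auto
      also have "\<dots> = (\<Sum>c\<in>C. (\<sigma> * size c) powr t)"
        unfolding sum_distrib_left using \<sigma> pos[OF C(2)] by (intro sum.cong refl) (simp add: powr_mult less_imp_le)
      also have "\<dots> \<le> (\<Sum>c\<in>C. \<Sum>i\<in>?J c. d i powr t)"
      proof (rule sum_mono)
        fix c assume c: "c \<in> C"
        show "(\<sigma> * size c) powr t \<le> (\<Sum>i\<in>?J c. d i powr t)"
          by (rule Suc.IH[OF _ C(2)[OF c]]) (use C(3)[OF c] Suc(2) in simp)
      qed
      also have "\<dots> = (\<Sum>i\<in>(\<Union>c\<in>C. ?J c). d i powr t)"
        by (rule sum.UNION_disjoint[symmetric]) (use C(1) I disj in auto)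
      also have "\<dots> \<le> (\<Sum>i\<in>?J n. d i powr t)"
        by (rule sum_mono2) (use I C(4) in auto)
      finally show ?thesis .
    qed
  qed
  obtain k where "size n / e \<le> 2 ^ k"
    by (meson real_arch_pow one_less_numeral_iff semiring_norm(76) less_imp_le)
  then have "size n \<le> 2 ^ k * e" using e(1) by (simp add: divide_le_eq)
  then show ?thesis by (rule main) fact
qed

text \<open>
Compactness allows passing from countable covers to finite ones, once every cover set is
replaced by an open neighbourhood. The diameters of the neighbourhoods are enlarged so little that the sum of the
powers grows by at most \<open>c / 4\<close>, and this also makes all sizes positive.
\<close>

lemma hausdorff_dim_ge_of_cover_sums:
  fixes X :: "'a::metric_space set"
  assumes "compact X" "0 < t" "0 < c"
    and cover: "\<And>I (U :: nat \<Rightarrow> 'a set) d. finite I \<Longrightarrow> X \<subseteq> (\<Union>i\<in>I. U i) \<Longrightarrow>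
      (\<And>i. i \<in> I \<Longrightarrow> 0 < d i) \<Longrightarrow> (\<And>i y z. i \<in> I \<Longrightarrow> y \<in> U i \<Longrightarrow> z \<in> U i \<Longrightarrow> dist y z \<le> d i) \<Longrightarrow>
      c \<le> (\<Sum>i\<in>I. d i powr t)"
  shows "ereal t \<le> hausdorff_dim X"
  unfolding hausdorff_dim_def
proof (rule INF_greatest, rule ccontr)
  fix s assume "s \<in> {s. 0 \<le> s \<and> hausdorff_measure s X = 0}" and "\<not> ereal t \<le> ereal s"
  then have s: "0 \<le> s" "s < t" and zero: "hausdorff_measure s X = 0" by auto
  have "hausdorff_premeasure s 1 X \<le> hausdorff_measure s X"
    unfolding hausdorff_measure_def by (rule SUP_upper) simp
  then have "hausdorff_premeasure s 1 X < ennreal (c / 2)"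
    using zero \<open>0 < c\<close> by simp
  then obtain U where U: "X \<subseteq> (\<Union>i. U i)" "\<And>i. bounded (U i)" "\<And>i. diameter (U i) \<le> 1"
    and small: "(\<Sum>i. diam_pow s (U i)) < ennreal (c / 2)"
    unfolding hausdorff_premeasure_def INF_less_iff by blast
  have "\<exists>e>0. (diameter (U i) + 2 * e) powr t \<le> diameter (U i) powr t + c / 4 * (1/2) ^ Suc i" for i
  proof -
    have "((\<lambda>e. (diameter (U i) + 2 * e) powr t) \<longlongrightarrow> (diameter (U i) + 2 * 0) powr t) (at_right 0)"
    proof (rule tendsto_powr')
      show "((\<lambda>e. diameter (U i) + 2 * e) \<longlongrightarrow> diameter (U i) + 2 * 0) (at_right 0)"
        by (intro tendsto_intros)
      show "diameter (U i) + 2 * 0 \<noteq> 0 \<or> 0 < t \<and> (\<forall>\<^sub>F e in at_right 0. 0 \<le> diameter (U i) + 2 * e)"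
        using \<open>0 < t\<close> diameter_ge_0[OF U(2)[of i]]
        by (auto simp: eventually_at_right_field intro!: exI[of _ 1])
    qed (rule tendsto_const)
    moreover have "(diameter (U i) + 2 * 0) powr t < diameter (U i) powr t + c / 4 * (1/2) ^ Suc i"
      using \<open>0 < c\<close> by simp
    ultimately have "\<forall>\<^sub>F e in at_right 0.
        (diameter (U i) + 2 * e) powr t < diameter (U i) powr t + c / 4 * (1/2) ^ Suc i"
      by (rule order_tendstoD)
    then obtain b where b: "b > 0" "\<And>e. 0 < e \<Longrightarrow> e < b \<Longrightarrow>
        (diameter (U i) + 2 * e) powr t < diameter (U i) powr t + c / 4 * (1/2) ^ Suc i"
      unfolding eventually_at_right_field by blast
    show ?thesis
      by (rule exI[of _ "b / 2"]) (use b(1) b(2)[of "b / 2"] in auto)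
  qed
  then obtain e where e: "\<And>i. e i > 0"
    "\<And>i. (diameter (U i) + 2 * e i) powr t \<le> diameter (U i) powr t + c / 4 * (1/2) ^ Suc i"
    by metis
  define V where "V i = (\<Union>y\<in>U i. ball y (e i))" for i
  define d where "d i = diameter (U i) + 2 * e i" for i
  have "X \<subseteq> (\<Union>i. V i)"
    using U(1) e(1) by (force simp: V_def)
  moreover have "open (V i)" for i by (auto simp: V_def)
  ultimately obtain I where I: "finite I" "X \<subseteq> (\<Union>i\<in>I. V i)"
    by (metis compactE_image[OF \<open>compact X\<close>, of UNIV V])
  have "c \<le> (\<Sum>i\<in>I. d i powr t)"
  proof (rule cover[OF I])
    show "0 < d i" for i using e(1)[of i] diameter_ge_0[OF U(2)[of i]] by (simp add: d_def)
    show "dist y z \<le> d i" if yV: "y \<in> V i" and zV: "z \<in> V i" for i y z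
    proof -
      obtain y' where y: "y' \<in> U i" "dist y' y < e i" using yV by (auto simp: V_def)
      obtain z' where z: "z' \<in> U i" "dist z' z < e i" using zV by (auto simp: V_def)
      then have "dist y' z' \<le> diameter (U i)"
        using diameter_bounded_bound[OF U(2)] y(1) z(1) by simp
      moreover have "dist y z \<le> dist y' y + dist y' z' + dist z' z"
        using dist_triangle[of y z y'] dist_triangle[of y' z z'] by (simp add: dist_commute)
      ultimately show ?thesis using y z by (simp add: d_def)
    qed
  qed
  also have "\<dots> \<le> (\<Sum>i\<in>I. diameter (U i) powr t + c / 4 * (1/2) ^ Suc i)"
    unfolding d_def by (intro sum_mono e(2))
  also have "\<dots> = (\<Sum>i\<in>I. diameter (U i) powr t) + c / 4 * (\<Sum>i\<in>I. (1/2) ^ Suc i)"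
    by (simp add: sum.distrib sum_distrib_left)
  also have "\<dots> < c / 2 + c / 4 * 1"
  proof (rule add_less_le_mono)
    have "ennreal (\<Sum>i\<in>I. diameter (U i) powr t) = (\<Sum>i\<in>I. ennreal (diameter (U i) powr t))"
      by (simp add: sum_ennreal)
    also have "\<dots> \<le> (\<Sum>i\<in>I. diam_pow s (U i))"
    proof (rule sum_mono)
      fix i
      have "diameter (U i) powr t \<le> diameter (U i) powr s"
        using s U(3)[of i] diameter_ge_0[OF U(2)[of i]]
        by (cases "diameter (U i) = 0") (auto intro: powr_mono')
      moreover have "diameter (U i) powr t \<le> 1"
        using \<open>0 < t\<close> U(3)[of i] diameter_ge_0[OF U(2)[of i]] by (simp add: powr_le1)
      ultimately show "ennreal (diameter (U i) powr t) \<le> diam_pow s (U i)"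
        by (auto simp: diam_pow_def ennreal_le_1 intro: ennreal_leI)
    qed
    also have "\<dots> \<le> (\<Sum>i. diam_pow s (U i))"
      by (rule sum_le_suminf) (use I(1) in auto)
    finally have "ennreal (\<Sum>i\<in>I. diameter (U i) powr t) < ennreal (c / 2)"
      using small by (rule le_less_trans)
    then show "(\<Sum>i\<in>I. diameter (U i) powr t) < c / 2"
      using \<open>0 < c\<close> by (simp add: ennreal_less_iff sum_nonneg)
    have "(\<Sum>i\<in>I. (1/2::real) ^ Suc i) \<le> (\<Sum>i. (1/2) ^ Suc i)"
      by (rule sum_le_suminf) (use I(1) power_half_series sums_summable in auto)
    also have "\<dots> = 1" using power_half_series by (rule sums_unique[symmetric])
    finally show "c / 4 * (\<Sum>i\<in>I. (1/2) ^ Suc i) \<le> c / 4 * 1"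
      using \<open>0 < c\<close> by (intro mult_left_mono) auto
  qed
  finally show False using \<open>0 < c\<close> by simp
qed

section \<open>Chains, chain distance and separated families of continua\<close>

definition chain :: "real \<Rightarrow> 'a::metric_space set \<Rightarrow> (nat \<Rightarrow> 'a) \<Rightarrow> nat \<Rightarrow> bool" where
  "chain \<epsilon> E x n \<longleftrightarrow> (\<forall>i\<le>n. x i \<in> E) \<and> (\<forall>i<n. dist (x i) (x (Suc i)) \<le> \<epsilon>)"

definition chain_length :: "(nat \<Rightarrow> 'a::metric_space) \<Rightarrow> nat \<Rightarrow> real" where
  "chain_length x n = (\<Sum>i<n. dist (x i) (x (Suc i)))"

text \<open>
A discrete substitute for the length of a shortest curve in \<open>E\<close>. It is finite on every continuum, which
need not contain any curve, and it takes into account all detours that \<open>E\<close> forces at scales above \<open>\<epsilon>\<close>.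
\<close>

definition chain_dist :: "real \<Rightarrow> 'a::metric_space set \<Rightarrow> 'a \<Rightarrow> 'a \<Rightarrow> real" where
  "chain_dist \<epsilon> E a y = Inf {chain_length x n | x n. chain \<epsilon> E x n \<and> x 0 = a \<and> x n = y}"

lemma chain_length_Suc: "chain_length x (Suc n) = chain_length x n + dist (x n) (x (Suc n))"
  by (simp add: chain_length_def)

lemma chain_length_nonneg: "0 \<le> chain_length x n"
  by (simp add: chain_length_def sum_nonneg)

lemma dist_le_chain_length_diff:
  "i \<le> j \<Longrightarrow> dist (x i) (x j) \<le> chain_length x j - chain_length x i"
proof (induction j rule: dec_induct)
  case (step j)
  then show ?case
    using dist_triangle[of "x i" "x (Suc j)" "x j"] by (simp add: chain_length_Suc)
qed simp

lemma chain_length_mono: "i \<le> j \<Longrightarrow> chain_length x i \<le> chain_length x j"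
  using dist_le_chain_length_diff[of i j x] zero_le_dist[of "x i" "x j"] by linarith

lemma chain_snoc:
  assumes "chain \<epsilon> E x n" "y \<in> E" "dist (x n) y \<le> \<epsilon>"
  shows "chain \<epsilon> E (x(Suc n := y)) (Suc n)"
    and "chain_length (x(Suc n := y)) (Suc n) = chain_length x n + dist (x n) y"
proof -
  show "chain \<epsilon> E (x(Suc n := y)) (Suc n)"
    using assms by (auto simp: chain_def less_Suc_eq le_Suc_eq)
  have "chain_length (x(Suc n := y)) n = chain_length x n"
    unfolding chain_length_def by (intro sum.cong) auto
  then show "chain_length (x(Suc n := y)) (Suc n) = chain_length x n + dist (x n) y"
    by (simp add: chain_length_Suc)
qed

lemma chain_exists:
  fixes E :: "'a::metric_space set"
  assumes "connected E" "a \<in> E" "b \<in> E" "0 < \<epsilon>"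
  shows "\<exists>x n. chain \<epsilon> E x n \<and> x 0 = a \<and> x n = b"
proof (rule connected_induction_simple[OF assms(1-3)])
  show "\<exists>x n. chain \<epsilon> E x n \<and> x 0 = a \<and> x n = a"
    using \<open>a \<in> E\<close> by (intro exI[of _ "\<lambda>_. a"] exI[of _ 0]) (simp add: chain_def)
  fix p assume p: "p \<in> E"
  show "\<exists>T. openin (top_of_set E) T \<and> p \<in> T \<and>
      (\<forall>y\<in>T. \<forall>z\<in>T. (\<exists>x n. chain \<epsilon> E x n \<and> x 0 = a \<and> x n = y) \<longrightarrow>
        (\<exists>x n. chain \<epsilon> E x n \<and> x 0 = a \<and> x n = z))"
  proof (intro exI[of _ "E \<inter> ball p (\<epsilon> / 2)"] conjI ballI impI)
    show "openin (top_of_set E) (E \<inter> ball p (\<epsilon> / 2))" by (simp add: openin_open_Int)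
    show "p \<in> E \<inter> ball p (\<epsilon> / 2)" using p \<open>0 < \<epsilon>\<close> by simp
    fix y z assume y: "y \<in> E \<inter> ball p (\<epsilon> / 2)" and z: "z \<in> E \<inter> ball p (\<epsilon> / 2)"
      and "\<exists>x n. chain \<epsilon> E x n \<and> x 0 = a \<and> x n = y"
    then obtain x n where x: "chain \<epsilon> E x n" "x 0 = a" "x n = y" by blast
    have "dist y z \<le> \<epsilon>"
      using dist_triangle2[of y z p] y z by (simp add: dist_commute)
    then have "chain \<epsilon> E (x(Suc n := z)) (Suc n)"
      using chain_snoc(1)[OF x(1)] x(3) z by simp
    then show "\<exists>x n. chain \<epsilon> E x n \<and> x 0 = a \<and> x n = z"
      using x(2) by (intro exI[of _ "x(Suc n := z)"] exI[of _ "Suc n"]) auto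
  qed
qed

lemma chain_dist_le: "chain \<epsilon> E x n \<Longrightarrow> x 0 = a \<Longrightarrow> x n = y \<Longrightarrow> chain_dist \<epsilon> E a y \<le> chain_length x n"
  unfolding chain_dist_def
  by (rule cInf_lower) (auto intro!: bdd_belowI[of _ 0] simp: chain_length_nonneg)

lemma chain_dist_step:
  assumes "connected E" "0 < \<epsilon>" "a \<in> E" "y \<in> E" "z \<in> E" "dist y z \<le> \<epsilon>"
  shows "chain_dist \<epsilon> E a z \<le> chain_dist \<epsilon> E a y + dist y z"
proof -
  have "chain_dist \<epsilon> E a z - dist y z \<le> chain_dist \<epsilon> E a y"
    unfolding chain_dist_def[of \<epsilon> E a y]
  proof (rule cInf_greatest)
    show "{chain_length x n |x n. chain \<epsilon> E x n \<and> x 0 = a \<and> x n = y} \<noteq> {}"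
      using chain_exists[OF assms(1,3,4,2)] by blast
    fix l assume "l \<in> {chain_length x n |x n. chain \<epsilon> E x n \<and> x 0 = a \<and> x n = y}"
    then obtain x n where x: "l = chain_length x n" "chain \<epsilon> E x n" "x 0 = a" "x n = y" by blast
    have "chain_dist \<epsilon> E a z \<le> chain_length (x(Suc n := z)) (Suc n)"
      using chain_snoc(1)[OF x(2) \<open>z \<in> E\<close>] x(3,4) assms(6) by (intro chain_dist_le) auto
    then show "chain_dist \<epsilon> E a z - dist y z \<le> l"
      using chain_snoc(2)[OF x(2) \<open>z \<in> E\<close>] x(1,4) assms(6) by simp
  qed
  then show ?thesis by simp
qed

text \<open>
The chain distance is 1-Lipschitz only at scales up to \<open>\<epsilon>\<close>. That is enough for cutting \<open>E\<close>
along its level sets into pieces of size \<open>\<epsilon>\<close> with gaps of at most \<open>\<epsilon>\<close>.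
\<close>

lemma abs_chain_dist_diff_le:
  assumes "connected E" "0 < \<epsilon>" "a \<in> E" "y \<in> E" "z \<in> E" "dist y z \<le> \<epsilon>"
  shows "\<bar>chain_dist \<epsilon> E a y - chain_dist \<epsilon> E a z\<bar> \<le> dist y z"
  using chain_dist_step[OF assms] chain_dist_step[OF assms(1-3,5,4)] assms(6)
  by (simp add: dist_commute)

lemma continuous_on_chain_dist:
  assumes "connected E" "0 < \<epsilon>" "a \<in> E"
  shows "continuous_on E (chain_dist \<epsilon> E a)"
  unfolding continuous_on_iff
proof (intro ballI allI impI)
  fix y and e :: real assume "y \<in> E" "0 < e"
  then show "\<exists>d>0. \<forall>z\<in>E. dist z y < d \<longrightarrow> dist (chain_dist \<epsilon> E a z) (chain_dist \<epsilon> E a y) < e"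
    using abs_chain_dist_diff_le[OF assms] \<open>0 < \<epsilon>\<close>
    by (intro exI[of _ "min \<epsilon> e"]) (fastforce simp: dist_real_def)
qed

text \<open>
A member \<open>(F, l)\<close> is a continuum with a guaranteed size: \<open>l\<close> is a lower bound for its diameter,
witnessed by two points, and may be chosen smaller than the diameter. All sizes lie in \<open>[\<theta>, m]\<close>, and distinct
members have distance at least \<open>\<gamma>\<close>.
\<close>

definition packing :: "real \<Rightarrow> real \<Rightarrow> real \<Rightarrow> ('a::metric_space set \<times> real) set \<Rightarrow> bool" where
  "packing \<theta> m \<gamma> \<F> \<longleftrightarrow> finite \<F> \<and>
     (\<forall>(F, l)\<in>\<F>. compact F \<and> connected F \<and> \<theta> \<le> l \<and> l \<le> m \<and> (\<exists>y\<in>F. \<exists>z\<in>F. l \<le> dist y z)) \<and>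
     (\<forall>A\<in>\<F>. \<forall>B\<in>\<F>. A \<noteq> B \<longrightarrow> (\<forall>y\<in>fst A. \<forall>z\<in>fst B. \<gamma> \<le> dist y z))"

definition carrier :: "('a set \<times> real) set \<Rightarrow> 'a set" where
  "carrier \<F> = \<Union> (fst ` \<F>)"

lemma carrier_simps [simp]:
  "carrier {} = {}" "carrier {(F, l)} = F" "carrier (\<F> \<union> \<G>) = carrier \<F> \<union> carrier \<G>"
  "carrier (\<Union>i\<in>I. \<H> i) = (\<Union>i\<in>I. carrier (\<H> i))"
  by (auto simp: carrier_def)

lemma packing_empty [simp]: "packing \<theta> m \<gamma> {}"
  by (simp add: packing_def)

lemma packing_single:
  "compact F \<Longrightarrow> connected F \<Longrightarrow> \<theta> \<le> l \<Longrightarrow> l \<le> m \<Longrightarrow> y \<in> F \<Longrightarrow> z \<in> F \<Longrightarrow> l \<le> dist y z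
    \<Longrightarrow> packing \<theta> m \<gamma> {(F, l)}"
  by (auto simp: packing_def)

text \<open>
Sizes add up because separated families are disjoint: a common member would be at positive
distance from itself.
\<close>

lemma packing_Un:
  assumes "packing \<theta> m \<gamma> \<F>" "packing \<theta> m \<gamma> \<G>" "0 < \<gamma>"
    and sep: "\<And>y z. y \<in> carrier \<F> \<Longrightarrow> z \<in> carrier \<G> \<Longrightarrow> \<gamma> \<le> dist y z"
  shows "packing \<theta> m \<gamma> (\<F> \<union> \<G>)" and "sum snd (\<F> \<union> \<G>) = sum snd \<F> + sum snd \<G>"
proof -
  have sep': "\<gamma> \<le> dist y z" "\<gamma> \<le> dist z y" if "A \<in> \<F>" "B \<in> \<G>" "y \<in> fst A" "z \<in> fst B" for A B y z
    using sep[of y z] that by (auto simp: carrier_def dist_commute)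
  show "packing \<theta> m \<gamma> (\<F> \<union> \<G>)"
    unfolding packing_def
  proof (intro conjI)
    show "\<forall>A\<in>\<F> \<union> \<G>. \<forall>B\<in>\<F> \<union> \<G>. A \<noteq> B \<longrightarrow> (\<forall>y\<in>fst A. \<forall>z\<in>fst B. \<gamma> \<le> dist y z)"
    proof (intro ballI impI)
      fix A B y z assume "A \<in> \<F> \<union> \<G>" "B \<in> \<F> \<union> \<G>" "A \<noteq> B" "y \<in> fst A" "z \<in> fst B"
      then show "\<gamma> \<le> dist y z"
        using assms(1,2) sep'(1)[of A B y z] sep'(2)[of B A z y] unfolding packing_def by (elim UnE) auto
    qed
  qed (use assms(1,2) in \<open>auto simp: packing_def\<close>)
  have "\<F> \<inter> \<G> = {}"
  proof (rule ccontr)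
    assume "\<F> \<inter> \<G> \<noteq> {}"
    then obtain A where "A \<in> \<F>" "A \<in> \<G>" by blast
    moreover then obtain y where "y \<in> fst A"
      using assms(1) unfolding packing_def by force
    ultimately have "\<gamma> \<le> dist y y" using sep'(1) by blast
    then show False using \<open>0 < \<gamma>\<close> by simp
  qed
  then show "sum snd (\<F> \<union> \<G>) = sum snd \<F> + sum snd \<G>"
    using assms(1,2) by (simp add: packing_def sum.union_disjoint)
qed

lemma packing_UN:
  assumes "finite I" "0 < \<gamma>" and "\<And>i. i \<in> I \<Longrightarrow> packing \<theta> m \<gamma> (\<H> i)"
    and "\<And>i j y z. i \<in> I \<Longrightarrow> j \<in> I \<Longrightarrow> i \<noteq> j \<Longrightarrow> y \<in> carrier (\<H> i) \<Longrightarrow> z \<in> carrier (\<H> j) \<Longrightarrow> \<gamma> \<le> dist y z"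
  shows "packing \<theta> m \<gamma> (\<Union>i\<in>I. \<H> i) \<and> sum snd (\<Union>i\<in>I. \<H> i) = (\<Sum>i\<in>I. sum snd (\<H> i))"
  using assms(1,3,4)
proof (induction I rule: finite_induct)
  case (insert i I)
  have IH: "packing \<theta> m \<gamma> (\<Union>i\<in>I. \<H> i)" "sum snd (\<Union>i\<in>I. \<H> i) = (\<Sum>i\<in>I. sum snd (\<H> i))"
    using insert.IH insert.prems by blast+
  have "\<gamma> \<le> dist y z" if "y \<in> carrier (\<H> i)" "z \<in> carrier (\<Union>i\<in>I. \<H> i)" for y z
    using that insert.prems(2)[of i _ y z] insert.hyps by auto
  note U = packing_Un[OF insert.prems(1)[of i] IH(1) \<open>0 < \<gamma>\<close> this]
  show ?case
    using U IH(2) insert.hyps by simp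
qed simp

text \<open>
The slabs of width \<open>\<epsilon>\<close> and period \<open>\<epsilon> + \<gamma>\<close> of the chain distance from \<open>a\<close> each contain a
continuum crossing them. It has two points at distance at least \<open>\<epsilon>\<close>, because points closer than \<open>\<epsilon>\<close>
have chain distances that differ by less than \<open>\<epsilon>\<close>; and the gaps of the slabs separate the continua for the same
reason.
\<close>

lemma packing_of_chain_dist:
  fixes E :: "'a::metric_space set"
  assumes E: "compact E" "connected E" "a \<in> E" "b \<in> E" and \<gamma>: "0 < \<gamma>" "\<gamma> \<le> \<epsilon>"
  obtains \<F> where "packing \<epsilon> \<epsilon> \<gamma> \<F>" "carrier \<F> \<subseteq> E"
    "\<epsilon> * (chain_dist \<epsilon> E a b / (\<epsilon> + \<gamma>) - 1) \<le> sum snd \<F>"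
proof -
  have \<epsilon>: "0 < \<epsilon>" using \<gamma> by linarith
  define g where "g = chain_dist \<epsilon> E a"
  define n where "n = nat \<lfloor>g b / (\<epsilon> + \<gamma>)\<rfloor>"
  have ga: "g a \<le> 0"
    unfolding g_def
    by (rule order_trans[OF chain_dist_le[of _ _ "\<lambda>_. a" 0]]) (use \<open>a \<in> E\<close> in \<open>auto simp: chain_def chain_length_def\<close>)
  define u where "u i = real i * (\<epsilon> + \<gamma>)" for i
  have gap: "u i + \<epsilon> + \<gamma> \<le> u j" if "i < j" for i j
  proof -
    have "(real i + 1) * (\<epsilon> + \<gamma>) \<le> real j * (\<epsilon> + \<gamma>)"
      using that \<epsilon> \<gamma> by (intro mult_right_mono) auto
    then show ?thesis by (simp add: u_def algebra_simps)
  qed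
  have "\<exists>Q. compact Q \<and> connected Q \<and> Q \<subseteq> E \<and> (\<forall>z\<in>Q. u i \<le> g z \<and> g z \<le> u i + \<epsilon>) \<and>
      (\<exists>y\<in>Q. \<exists>z\<in>Q. \<epsilon> \<le> dist y z)" if "i < n" for i
  proof -
    have "u i + \<epsilon> \<le> g b"
    proof -
      have "real i + 1 \<le> g b / (\<epsilon> + \<gamma>)"
        using that by (simp add: n_def) linarith
      then have "(real i + 1) * (\<epsilon> + \<gamma>) \<le> g b"
        using \<epsilon> \<gamma> by (simp add: pos_le_divide_eq)
      then show ?thesis using \<gamma> by (simp add: u_def algebra_simps)
    qed
    moreover have "g a \<le> u i" using ga \<epsilon> \<gamma> by (simp add: u_def order_trans)
    ultimately obtain Q p q where Q: "compact Q" "connected Q" "Q \<subseteq> E"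
      "\<And>z. z \<in> Q \<Longrightarrow> u i \<le> g z \<and> g z \<le> u i + \<epsilon>" "p \<in> Q" "g p = u i" "q \<in> Q" "g q = u i + \<epsilon>"
      using subcontinuum_crossing[of E g a "u i" b "u i + \<epsilon>"] E \<epsilon>
        continuous_on_chain_dist[OF E(2) \<epsilon> E(3)] unfolding g_def by auto
    have "\<epsilon> \<le> dist p q"
    proof (rule ccontr)
      assume "\<not> \<epsilon> \<le> dist p q"
      moreover have "p \<in> E" "q \<in> E" using Q by auto
      ultimately have "\<bar>g p - g q\<bar> \<le> dist p q"
        unfolding g_def by (intro abs_chain_dist_diff_le[OF E(2) \<epsilon> E(3)]) auto
      then show False using Q(6,8) \<epsilon> \<open>\<not> \<epsilon> \<le> dist p q\<close> by simp
    qed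
    with Q show ?thesis by blast
  qed
  then obtain Q where Q: "\<And>i. i < n \<Longrightarrow> compact (Q i)" "\<And>i. i < n \<Longrightarrow> connected (Q i)"
    "\<And>i. i < n \<Longrightarrow> Q i \<subseteq> E" "\<And>i z. i < n \<Longrightarrow> z \<in> Q i \<Longrightarrow> u i \<le> g z \<and> g z \<le> u i + \<epsilon>"
    "\<And>i. i < n \<Longrightarrow> \<exists>y\<in>Q i. \<exists>z\<in>Q i. \<epsilon> \<le> dist y z"
    by metis
  have sep: "\<gamma> \<le> dist y z" if "i < n" "j < n" "i < j" "y \<in> Q i" "z \<in> Q j" for i j y z
  proof (rule ccontr)
    assume *: "\<not> \<gamma> \<le> dist y z"
    have "g y + \<gamma> \<le> g z"
      using Q(4)[OF that(1,4)] Q(4)[OF that(2,5)] gap[OF that(3)] by linarith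
    moreover have "\<bar>g y - g z\<bar> \<le> dist y z"
      unfolding g_def
      by (rule abs_chain_dist_diff_le[OF E(2) \<epsilon> E(3)]) (use that(4,5) Q(3)[OF that(1)] Q(3)[OF that(2)] * \<gamma> in auto)
    ultimately show False using * by linarith
  qed
  have "packing \<epsilon> \<epsilon> \<gamma> (\<Union>i\<in>{..<n}. {(Q i, \<epsilon>)}) \<and>
      sum snd (\<Union>i\<in>{..<n}. {(Q i, \<epsilon>)}) = (\<Sum>i\<in>{..<n}. sum snd {(Q i, \<epsilon>)})"
  proof (rule packing_UN)
    show "packing \<epsilon> \<epsilon> \<gamma> {(Q i, \<epsilon>)}" if "i \<in> {..<n}" for i
      using that Q(1,2,5)[of i] by (auto intro: packing_single)
    show "\<gamma> \<le> dist y z" if "i \<in> {..<n}" "j \<in> {..<n}" "i \<noteq> j"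
      "y \<in> carrier {(Q i, \<epsilon>)}" "z \<in> carrier {(Q j, \<epsilon>)}" for i j y z
      using that sep[of i j y z] sep[of j i z y] by (cases "i < j") (auto simp: dist_commute)
  qed (use \<gamma> in auto)
  moreover have "\<epsilon> * (g b / (\<epsilon> + \<gamma>) - 1) \<le> (\<Sum>i\<in>{..<n}. sum snd {(Q i, \<epsilon>)})"
  proof -
    have "g b / (\<epsilon> + \<gamma>) - 1 \<le> real n" unfolding n_def by linarith
    then have "\<epsilon> * (g b / (\<epsilon> + \<gamma>) - 1) \<le> \<epsilon> * real n" using \<epsilon> by (intro mult_left_mono) auto
    then show ?thesis by (simp add: mult.commute)
  qed
  ultimately show ?thesis
    using that[of "\<Union>i\<in>{..<n}. {(Q i, \<epsilon>)}"] Q(3) by (auto simp: g_def)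
qed

section \<open>Continua close to a chain\<close>

text \<open>
A slab that a chain crosses contains continua near the chain of total size almost the
width of the slab, although the continuum \<open>E\<close> may leave the vicinity of the chain between any two
consecutive points of it. Each chain point in the slab has a component in the part of the slab within
distance \<open>v - u\<close> of the chain, and this component reaches the bottom, the top, or distance \<open>v - u\<close> from
the chain. The last case gives a single continuum of full size. Otherwise there are consecutive chain points
where the first component reaches the bottom and the second one the top; cut at the levels of these points,
the two components are separated by \<open>f\<close>, no matter how close they come to each other. The
loss \<open>\<gamma>\<close> is the gap between them, and the loss \<open>2 * \<theta>\<close> comes from dropping continua that are too small.
\<close>

lemma packing_near_chain:
  fixes E :: "'a::metric_space set"
  assumes E: "compact E" "connected E" and x: "chain \<epsilon> E x n" and f: "1-lipschitz_on UNIV f"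
    and ends: "f (x 0) \<le> u" "v \<le> f (x n)" "u < v"
    and "0 < \<gamma>" "0 < \<theta>" "\<theta> \<le> v - u" "0 \<le> \<epsilon>"
  obtains \<F> where "packing \<theta> (v - u) \<gamma> \<F>" "carrier \<F> \<subseteq> E"
    "\<And>y. y \<in> carrier \<F> \<Longrightarrow> u \<le> f y \<and> f y \<le> v \<and> infdist y (x ` {..n}) \<le> v - u"
    "v - u - \<epsilon> - \<gamma> - 2 * \<theta> \<le> sum snd \<F>"
proof -
  define S where "S = x ` {..n}"
  have lip: "\<bar>f y - f z\<bar> \<le> dist y z" for y z
    using lipschitz_onD[OF f, of y z] by (simp add: dist_real_def)
  have contf: "continuous_on A f" for A
    using lipschitz_on_continuous_on[OF f] continuous_on_subset by blast
  have xE: "x i \<in> E" if "i \<le> n" for i using x that by (simp add: chain_def)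
  have S0: "infdist (x i) S = 0" if "i \<le> n" for i using that by (simp add: S_def)
  define good where "good Q \<longleftrightarrow> compact Q \<and> connected Q \<and> Q \<subseteq> E \<and>
      (\<forall>z\<in>Q. u \<le> f z \<and> f z \<le> v \<and> infdist z S \<le> v - u)" for Q
  define fam where "fam u' v' c \<F> \<longleftrightarrow> packing \<theta> (v - u) \<gamma> \<F> \<and> carrier \<F> \<subseteq> E \<and>
      (\<forall>z\<in>carrier \<F>. u' \<le> f z \<and> f z \<le> v' \<and> infdist z S \<le> v - u) \<and> c \<le> sum snd \<F>" for u' v' c \<F>
  have single: "fam u' v' l {(Q, l)}"
    if "good Q" "\<forall>z\<in>Q. u' \<le> f z \<and> f z \<le> v'" "y \<in> Q" "z \<in> Q" "l \<le> dist y z" "\<theta> \<le> l" "l \<le> v - u"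
    for Q u' v' l y z
  proof -
    have "packing \<theta> (v - u) \<gamma> {(Q, l)}"
      by (rule packing_single[OF _ _ that(6,7,3,4,5)]) (use that(1) in \<open>auto simp: good_def\<close>)
    then show ?thesis using that(1,2) by (simp add: fam_def good_def)
  qed
  have bump: "\<exists>Q q. good Q \<and> x i \<in> Q \<and> q \<in> Q \<and> (f q = u \<or> f q = v \<or> infdist q S = v - u)"
    if i: "i \<le> n" "u \<le> f (x i)" "f (x i) \<le> v" for i
  proof -
    \<comment> \<open>The zero set of \<open>k\<close> consists of the walls: bottom, top, and distance \<open>v - u\<close> from the chain.\<close>
    define k where "k z = max (max (u - f z) (f z - v)) (infdist z S - (v - u))" for z
    have "continuous_on E k" unfolding k_def by (intro continuous_intros contf)
    moreover have "k (x i) \<le> 0" "0 \<le> k (x 0)"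
      using S0[OF i(1)] i ends by (simp_all add: k_def)
    ultimately obtain Q q where Q: "compact Q" "connected Q" "Q \<subseteq> E" "x i \<in> Q"
      "\<And>z. z \<in> Q \<Longrightarrow> k z \<le> 0" "q \<in> Q" "k q = 0"
      using subcontinuum_reaching_level[OF E, of k "x i" "x 0"] xE[OF i(1)] xE[of 0] by auto
    have "f q = u \<or> f q = v \<or> infdist q S = v - u"
      using Q(7) by (simp add: k_def max_def split: if_splits)
    moreover have "good Q"
      using Q(1-3,5) by (auto simp: good_def k_def)
    ultimately show ?thesis using Q by blast
  qed
  have "\<exists>\<F>. fam u v (v - u - \<epsilon> - \<gamma> - 2 * \<theta>) \<F>"
  proof (cases "\<exists>i\<le>n. \<exists>Q q. good Q \<and> x i \<in> Q \<and> q \<in> Q \<and> infdist q S = v - u")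
    case True
    then obtain i Q q where Q: "i \<le> n" "good Q" "x i \<in> Q" "q \<in> Q" "infdist q S = v - u" by blast
    have "infdist q S \<le> dist q (x i)"
      by (rule infdist_le) (use Q(1) in \<open>auto simp: S_def\<close>)
    then have "fam u v (v - u) {(Q, v - u)}"
      by (intro single[of _ _ _ q "x i"]) (use Q assms in \<open>auto simp: good_def\<close>)
    then have "fam u v (v - u - \<epsilon> - \<gamma> - 2 * \<theta>) {(Q, v - u)}"
      using assms by (auto simp: fam_def)
    then show ?thesis by blast
  next
    case near: False
    \<comment> \<open>The last index with this property marks the place where the chain changes from components
       that reach the bottom to components that reach the top.\<close>
    define low where "low i \<longleftrightarrow> f (x i) \<le> u \<or> (f (x i) \<le> v \<and> (\<exists>Q q. good Q \<and> x i \<in> Q \<and> q \<in> Q \<and> f q = u))" for i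
    have "low 0" using ends by (simp add: low_def)
    have "low n \<or> (\<exists>i<n. low i \<and> \<not> low (Suc i))"
    proof (rule ccontr)
      assume *: "\<not> ?thesis"
      have "i \<le> n \<Longrightarrow> low i" for i
        by (induction i) (use * \<open>low 0\<close> in auto)
      then show False using * by blast
    qed
    then consider "low n" | i where "i < n" "low i" "\<not> low (Suc i)" by blast
    then show ?thesis
    proof cases
      case 1
      then obtain Q q where Q: "good Q" "x n \<in> Q" "q \<in> Q" "f q = u"
        using ends by (auto simp: low_def)
      have "v - u \<le> dist (x n) q" using lip[of "x n" q] ends Q(4) by linarith
      then have "fam u v (v - u) {(Q, v - u)}"
        by (intro single[of _ _ _ "x n" q]) (use Q assms in \<open>auto simp: good_def\<close>)
      then have "fam u v (v - u - \<epsilon> - \<gamma> - 2 * \<theta>) {(Q, v - u)}"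
        using assms by (auto simp: fam_def)
      then show ?thesis by blast
    next
      case 2
      \<comment> \<open>The levels \<open>w - \<gamma>\<close> and \<open>m\<close> at which the two components are cut are \<open>\<gamma>\<close> to \<open>\<gamma> + \<epsilon>\<close> apart.\<close>
      define w m where "w = f (x i)" and "m = max (f (x i)) (f (x (Suc i)))"
      have "dist (x i) (x (Suc i)) \<le> \<epsilon>" using x 2(1) by (simp add: chain_def)
      then have m: "w \<le> m" "m \<le> w + \<epsilon>" "f (x (Suc i)) \<le> m"
        using lip[of "x i" "x (Suc i)"] \<open>0 \<le> \<epsilon>\<close> by (auto simp: w_def m_def)
      have lower: "\<exists>\<F>. fam u (w - \<gamma>) (w - \<gamma> - u - \<theta>) \<F>"
      proof (cases "w - \<gamma> - u < \<theta>")
        case True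
        then have "fam u (w - \<gamma>) (w - \<gamma> - u - \<theta>) {}" by (simp add: fam_def)
        then show ?thesis by blast
      next
        case False
        then obtain Q q where Q: "good Q" "x i \<in> Q" "q \<in> Q" "f q = u" and "w \<le> v"
          using 2(2) \<open>0 < \<gamma>\<close> \<open>0 < \<theta>\<close> by (auto simp: low_def w_def)
        have "continuous_on Q (\<lambda>z. f z - (w - \<gamma>))" by (intro continuous_intros contf)
        then obtain Q' q' where Q': "compact Q'" "connected Q'" "Q' \<subseteq> Q" "q \<in> Q'"
          "\<And>z. z \<in> Q' \<Longrightarrow> f z - (w - \<gamma>) \<le> 0" "q' \<in> Q'" "f q' - (w - \<gamma>) = 0"
          using subcontinuum_reaching_level[of Q "\<lambda>z. f z - (w - \<gamma>)" q "x i"] Q False \<open>0 < \<gamma>\<close> \<open>0 < \<theta>\<close>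
          by (auto simp: good_def w_def)
        have "w - \<gamma> - u \<le> dist q q'" using lip[of q q'] Q(4) Q'(7) by linarith
        moreover have "good Q'" using Q(1) Q'(1-3) by (auto simp: good_def)
        moreover have "\<forall>z\<in>Q'. u \<le> f z \<and> f z \<le> w - \<gamma>" using Q'(3,5) Q(1) by (auto simp: good_def)
        ultimately have "fam u (w - \<gamma>) (w - \<gamma> - u) {(Q', w - \<gamma> - u)}"
          using False Q'(4,6) \<open>w \<le> v\<close> \<open>0 < \<gamma>\<close> by (intro single[of _ _ _ q q']) auto
        then have "fam u (w - \<gamma>) (w - \<gamma> - u - \<theta>) {(Q', w - \<gamma> - u)}"
          using \<open>0 < \<theta>\<close> by (auto simp: fam_def)
        then show ?thesis by blast
      qed
      have upper: "\<exists>\<F>. fam m v (v - m - \<theta>) \<F>"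
      proof (cases "v - m < \<theta>")
        case True
        then have "fam m v (v - m - \<theta>) {}" by (simp add: fam_def)
        then show ?thesis by blast
      next
        case False
        have "u < f (x (Suc i))" using 2(3) by (auto simp: low_def)
        moreover have "f (x (Suc i)) \<le> v" using False m(3) \<open>0 < \<theta>\<close> by linarith
        ultimately obtain Q q where Q: "good Q" "x (Suc i) \<in> Q" "q \<in> Q"
          "f q = u \<or> f q = v \<or> infdist q S = v - u"
          using bump[of "Suc i"] 2(1) by auto
        have "f q \<noteq> u" using 2(3) Q \<open>f (x (Suc i)) \<le> v\<close> by (auto simp: low_def)
        moreover have "infdist q S \<noteq> v - u" using near Q(1-3) 2(1) by (meson Suc_leI)
        ultimately have "f q = v" using Q(4) by blast
        have "continuous_on Q (\<lambda>z. m - f z)" by (intro continuous_intros contf)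
        then obtain Q' q' where Q': "compact Q'" "connected Q'" "Q' \<subseteq> Q" "q \<in> Q'"
          "\<And>z. z \<in> Q' \<Longrightarrow> m - f z \<le> 0" "q' \<in> Q'" "m - f q' = 0"
          using subcontinuum_reaching_level[of Q "\<lambda>z. m - f z" q "x (Suc i)"] Q(1-3) m(3) False
            \<open>f q = v\<close> \<open>0 < \<theta>\<close> by (auto simp: good_def)
        have "v - m \<le> dist q q'" using lip[of q q'] \<open>f q = v\<close> Q'(7) by linarith
        moreover have "good Q'" using Q(1) Q'(1-3) by (auto simp: good_def)
        moreover have "\<forall>z\<in>Q'. m \<le> f z \<and> f z \<le> v" using Q'(3,5) Q(1) by (auto simp: good_def)
        moreover have "u \<le> m" using \<open>u < f (x (Suc i))\<close> m(3) by linarith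
        ultimately have "fam m v (v - m) {(Q', v - m)}"
          using False Q'(4,6) by (intro single[of _ _ _ q q']) auto
        then have "fam m v (v - m - \<theta>) {(Q', v - m)}"
          using \<open>0 < \<theta>\<close> by (auto simp: fam_def)
        then show ?thesis by blast
      qed
      obtain \<L> \<U> where L: "fam u (w - \<gamma>) (w - \<gamma> - u - \<theta>) \<L>" and U: "fam m v (v - m - \<theta>) \<U>"
        using lower upper by blast
      have pack: "packing \<theta> (v - u) \<gamma> \<L>" "packing \<theta> (v - u) \<gamma> \<U>"
        using L U by (auto simp: fam_def)
      have "\<gamma> \<le> dist y z" if "y \<in> carrier \<L>" "z \<in> carrier \<U>" for y z
      proof -
        have "f y \<le> w - \<gamma>" "m \<le> f z" using L U that by (auto simp: fam_def)
        then show ?thesis using lip[of y z] m(1) by linarith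
      qed
      note LU = packing_Un[OF pack \<open>0 < \<gamma>\<close> this]
      have "w - \<gamma> \<le> v \<or> carrier \<L> = {}" "u \<le> m"
      proof -
        show "u \<le> m" using 2(3) m(3) by (auto simp: low_def)
        have "w \<le> v \<or> w \<le> u" using 2(2) by (auto simp: low_def w_def)
        then show "w - \<gamma> \<le> v \<or> carrier \<L> = {}" using ends(3) \<open>0 < \<gamma>\<close> by auto
      qed
      then have "fam u v (v - u - \<epsilon> - \<gamma> - 2 * \<theta>) (\<L> \<union> \<U>)"
        using LU L U m(2) by (fastforce simp: fam_def)
      then show ?thesis by blast
    qed
  qed
  then show ?thesis using that unfolding fam_def S_def by blast
qed

section \<open>Points far from a straight chain\<close>

text \<open>
The polygon through the points of a chain, parametrised by arc length. A 1-Lipschitz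
parametrisation bounds both the length of the curve and its distance from each point of the chain.
\<close>

lemma polygon_lipschitz:
  fixes x :: "nat \<Rightarrow> 'a::real_normed_vector"
  shows "\<exists>c. (\<forall>i\<le>n. c (chain_length x i) = x i) \<and>
    (\<forall>u\<in>{0..chain_length x n}. \<forall>v\<in>{0..chain_length x n}. dist (c u) (c v) \<le> \<bar>u - v\<bar>)"
proof (induction n)
  case 0
  show ?case by (intro exI[of _ "\<lambda>_. x 0"]) (simp add: chain_length_def)
next
  case (Suc n)
  then obtain c where c: "\<And>i. i \<le> n \<Longrightarrow> c (chain_length x i) = x i"
    "\<And>u v. u \<in> {0..chain_length x n} \<Longrightarrow> v \<in> {0..chain_length x n} \<Longrightarrow> dist (c u) (c v) \<le> \<bar>u - v\<bar>"
    by blast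
  define T d where "T = chain_length x n" and "d = dist (x n) (x (Suc n))"
  define c' where "c' u = (if u \<le> T then c u else x n + ((u - T) / d) *\<^sub>R (x (Suc n) - x n))" for u
  have T0: "0 \<le> T" by (simp add: T_def chain_length_nonneg)
  have TS: "chain_length x (Suc n) = T + d" by (simp add: T_def d_def chain_length_Suc)
  have cT: "c T = x n" using c(1)[of n] by (simp add: T_def)
  have nd: "norm (x (Suc n) - x n) = d" by (simp add: d_def dist_norm norm_minus_commute)
  have "c' (chain_length x i) = x i" if "i \<le> Suc n" for i
  proof (cases "i \<le> n")
    case True
    then show ?thesis
      using c(1)[OF True] chain_length_mono[OF True, of x] by (simp add: c'_def T_def)
  next
    case False
    then have i: "i = Suc n" using that by simp
    show ?thesis
    proof (cases "d = 0")
      case True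
      then show ?thesis using cT by (simp add: i TS c'_def d_def)
    next
      case False
      then have "0 < d" by (simp add: d_def)
      then show ?thesis by (simp add: i TS c'_def)
    qed
  qed
  moreover have "dist (c' u) (c' v) \<le> \<bar>u - v\<bar>"
    if "u \<in> {0..chain_length x (Suc n)}" "v \<in> {0..chain_length x (Suc n)}" for u v
  proof -
    have late: "dist (x n) (c' v) \<le> v - T" if "T < v" for v
      using that nd by (auto simp: c'_def dist_norm divide_simps)
    have le: "dist (c' u) (c' v) \<le> v - u" if "0 \<le> u" "u \<le> v" for u v
    proof (cases "v \<le> T")
      case True
      then show ?thesis using that c(2)[of u v] by (simp add: c'_def T_def)
    next
      case v: False
      show ?thesis
      proof (cases "u \<le> T")
        case True
        then have "dist (c' u) (x n) \<le> T - u"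
          using that c(2)[of u T] T0 cT by (simp add: c'_def T_def)
        then show ?thesis
          using late[of v] v dist_triangle[of "c' u" "c' v" "x n"] by simp
      next
        case False
        have "c' u - c' v = ((u - v) / d) *\<^sub>R (x (Suc n) - x n)"
        proof -
          have "c' u - c' v = ((u - T) / d - (v - T) / d) *\<^sub>R (x (Suc n) - x n)"
            using False v unfolding scaleR_left_diff_distrib by (simp add: c'_def)
          then show ?thesis by (simp add: diff_divide_distrib)
        qed
        moreover have "0 \<le> d" by (simp add: d_def)
        ultimately show ?thesis using nd that by (auto simp: dist_norm divide_simps)
      qed
    qed
    show ?thesis
      using le[of u v] le[of v u] that by (cases "u \<le> v") (auto simp: dist_commute)
  qed
  ultimately show ?case by blast
qed

lemma curve_length_le_of_lipschitz:
  assumes lip: "\<And>u v. u \<in> {0..1} \<Longrightarrow> v \<in> {0..1} \<Longrightarrow> dist (s u) (s v) \<le> l * \<bar>u - v\<bar>"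
  shows "curve_length s \<le> ereal l"
  unfolding curve_length_def
proof (rule SUP_least, clarify)
  fix n and t :: "nat \<Rightarrow> real"
  assume t: "t 0 = 0" "t n = 1" "\<forall>i<n. t i < t (Suc i)"
  have mono: "t i \<le> t j" if "i \<le> j" "j \<le> n" for i j
    using that(1) that(2)
  proof (induction j rule: dec_induct)
    case (step j)
    then show ?case using t(3) by (metis Suc_leD Suc_le_eq less_imp_le order_trans)
  qed simp
  have mem: "t i \<in> {0..1}" if "i \<le> n" for i
    using mono[of 0 i] mono[of i n] t(1,2) that by simp
  have "(\<Sum>i<n. dist (s (t i)) (s (t (Suc i)))) \<le> (\<Sum>i<n. l * (t (Suc i) - t i))"
  proof (rule sum_mono)
    fix i assume "i \<in> {..<n}"
    then show "dist (s (t i)) (s (t (Suc i))) \<le> l * (t (Suc i) - t i)"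
      using lip[of "t i" "t (Suc i)"] mem[of i] mem[of "Suc i"] t(3) by force
  qed
  also have "\<dots> = l * (t n - t 0)"
    by (simp add: sum_distrib_left[symmetric] sum_lessThan_telescope)
  finally show "ereal (\<Sum>i<n. dist (s (t i)) (s (t (Suc i)))) \<le> ereal l"
    using t(1,2) by simp
qed

text \<open>
Every Lipschitz curve is a competitor in the infimum, and its Lipschitz constant on the unit
interval bounds its length.
\<close>

lemma beta'_le:
  assumes lip: "\<And>u v. u \<in> {0..1} \<Longrightarrow> v \<in> {0..1} \<Longrightarrow> dist (s u) (s v) \<le> l * \<bar>u - v\<bar>"
    and img: "path_image s \<subseteq> ball x r" and ends: "s 0 \<noteq> s 1"
    and X: "x \<in> X" "0 < r" and near: "\<And>z. z \<in> X \<inter> ball x r \<Longrightarrow> infdist z (path_image s) \<le> h"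
  shows "beta' X x r \<le> ereal ((l - dist (s 0) (s 1) + h) / dist (s 0) (s 1))"
proof -
  have d: "0 < norm (s 0 - s 1)" using ends by simp
  have "0 < dist (s 0) (s 1)" using ends by simp
  also have "\<dots> \<le> l" using lip[of 0 1] by simp
  finally have "0 \<le> l" by simp
  then have "l-lipschitz_on {0..1} s"
    using lip by (auto simp: lipschitz_on_def dist_real_def)
  then have "path s"
    unfolding path_def by (rule lipschitz_on_continuous_on)
  have "beta' X x r \<le> (curve_length s - ereal (norm (s 0 - s 1))
      + (SUP z \<in> X \<inter> ball x r. ereal (infdist z (path_image s)))) / ereal (norm (s 0 - s 1))"
    unfolding beta'_def by (rule INF_lower[OF CollectI]) (use \<open>path s\<close> img ends in auto)
  also have "\<dots> \<le> (ereal l - ereal (norm (s 0 - s 1)) + ereal h) / ereal (norm (s 0 - s 1))"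
  proof (intro ereal_divide_right_mono add_mono ereal_minus_mono)
    show "curve_length s \<le> ereal l" by (rule curve_length_le_of_lipschitz) (rule lip)
    show "(SUP z \<in> X \<inter> ball x r. ereal (infdist z (path_image s))) \<le> ereal h"
      by (rule SUP_least) (use near in auto)
  qed (use d in auto)
  also have "\<dots> = ereal ((l - dist (s 0) (s 1) + h) / dist (s 0) (s 1))"
    using ends by (simp add: dist_norm)
  finally show ?thesis .
qed

text \<open>
The competitor is a segment of length \<open>r / 2\<close> that starts at \<open>x\<close>, in an arbitrary
direction. The case \<open>h = r\<close> shows that \<open>\<beta>'\<close> never exceeds \<open>2\<close>, and \<open>h = 0\<close> shows that it vanishes
for a set that is a single point near \<open>x\<close>.
\<close>

lemma beta'_le_of_subset_cball:
  assumes "x \<in> X" "0 < r" "\<And>z. z \<in> X \<inter> ball x r \<Longrightarrow> dist z x \<le> h"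
  shows "beta' X x r \<le> ereal (2 * h / r)"
proof -
  define e :: linf where "e = const_bcontfun 1"
  have "apply_bcontfun e 0 = 1" by (simp add: e_def const_bcontfun.rep_eq)
  then have "e \<noteq> 0" by (metis zero_neq_one zero_bcontfun.rep_eq)
  define w where "w = (r / (2 * norm e)) *\<^sub>R e"
  have w: "norm w = r / 2" using \<open>e \<noteq> 0\<close> \<open>0 < r\<close> by (simp add: w_def)
  define s where "s t = x + t *\<^sub>R w" for t :: real
  have ds: "dist (s u) (s v) = r / 2 * \<bar>u - v\<bar>" for u v
    by (simp add: s_def dist_norm w flip: scaleR_left_diff_distrib)
  have d: "dist (s 0) (s 1) = r / 2" by (simp add: ds)
  have "beta' X x r \<le> ereal ((r / 2 - dist (s 0) (s 1) + h) / dist (s 0) (s 1))"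
  proof (rule beta'_le)
    have "dist x (s t) \<le> r / 2" if "t \<in> {0..1}" for t
    proof -
      have "dist (s 0) (s t) \<le> r / 2 * 1"
        unfolding ds using that \<open>0 < r\<close> by (intro mult_left_mono) auto
      then show ?thesis by (simp add: s_def)
    qed
    then show "path_image s \<subseteq> ball x r"
      using \<open>0 < r\<close> by (force simp: path_image_def)
    show "infdist z (path_image s) \<le> h" if "z \<in> X \<inter> ball x r" for z
    proof -
      have "x \<in> path_image s"
        unfolding path_image_def by (rule image_eqI[of _ _ 0]) (auto simp: s_def)
      then show ?thesis using infdist_le[of x "path_image s" z] assms(3)[OF that] by linarith
    qed
    show "s 0 \<noteq> s 1" using ds[of 0 1] \<open>0 < r\<close> by auto
  qed (use ds assms in auto)
  also have "(r / 2 - dist (s 0) (s 1) + h) / dist (s 0) (s 1) = 2 * h / r"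
    unfolding d by simp
  finally show ?thesis .
qed

lemma chain_length_shift:
  "chain_length (\<lambda>i. x (p + i)) n = chain_length x (p + n) - chain_length x p"
  by (induction n) (simp_all add: chain_length_Suc, simp add: chain_length_def)

text \<open>
The first point of the chain at which the arc length reaches \<open>w\<close> overshoots by at most one step.
\<close>

lemma chain_index_at_length:
  assumes "chain \<epsilon> E x n" "0 \<le> w" "w \<le> chain_length x n" "0 \<le> \<epsilon>"
  obtains p where "p \<le> n" "w \<le> chain_length x p" "chain_length x p \<le> w + \<epsilon>"
proof -
  define p where "p = (LEAST p. w \<le> chain_length x p)"
  have p: "w \<le> chain_length x p" "p \<le> n"
    unfolding p_def using assms(3) by (auto intro: LeastI Least_le)
  have "chain_length x p \<le> w + \<epsilon>"
  proof (cases p)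
    case 0
    then show ?thesis using assms by (simp add: chain_length_def)
  next
    case (Suc k)
    then have "chain_length x k < w"
      using not_less_Least[of k "\<lambda>p. w \<le> chain_length x p"] by (simp add: p_def)
    moreover have "dist (x k) (x (Suc k)) \<le> \<epsilon>" using assms(1) p(2) Suc by (simp add: chain_def)
    ultimately show ?thesis by (simp add: Suc chain_length_Suc)
  qed
  with p that show ?thesis by blast
qed

text \<open>
The competitor is the polygon through the middle half of the chain, in the ball around the midpoint with
radius slightly larger than \<open>L / 4\<close>. Only a point \<open>z\<close> far from the middle half is found in this way; but if \<open>z\<close>
were close to another point of the chain, this point would lie in nearly the same ball. As arc length and distance along
the chain differ by at most the excess \<open>e\<close>, it would then be close to an end of the middle half, and so would \<open>z\<close>.
\<close>

lemma far_point_near_chain: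
  fixes X :: "linf set"
  assumes beta: "\<forall>x\<in>X. \<forall>r\<in>{0<..<r0}. ereal \<beta> < beta' X x r"
    and x: "chain \<epsilon> X x n" and \<beta>: "0 < \<beta>" "\<beta> \<le> 1"
    and L: "L = chain_length x n" "0 < L" "L < r0"
    and straight: "L \<le> dist (x 0) (x n) + e" "e \<le> \<beta> * L / 64"
    and \<epsilon>: "0 \<le> \<epsilon>" "\<epsilon> \<le> \<beta> * L / 64"
  obtains m z where "m \<le> n" "z \<in> X" "dist z (x m) \<le> L / 3"
    "L / 2 \<le> chain_length x m" "chain_length x m \<le> L / 2 + \<epsilon>"
    "\<And>i. i \<le> n \<Longrightarrow> \<beta> * L / 16 \<le> dist z (x i)"
proof -
  let ?t = "chain_length x"
  have \<beta>L: "0 < \<beta> * L" "\<beta> * L \<le> L" using \<beta> L by simp_all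
  obtain p where p: "p \<le> n" "L / 4 \<le> ?t p" "?t p \<le> L / 4 + \<epsilon>"
    using chain_index_at_length[OF x, of "L / 4"] L \<epsilon> by auto
  obtain m where m: "m \<le> n" "L / 2 \<le> ?t m" "?t m \<le> L / 2 + \<epsilon>"
    using chain_index_at_length[OF x, of "L / 2"] L \<epsilon> by auto
  obtain q where q: "q \<le> n" "3 * L / 4 \<le> ?t q" "?t q \<le> 3 * L / 4 + \<epsilon>"
    using chain_index_at_length[OF x, of "3 * L / 4"] L \<epsilon> by auto
  have order: "p \<le> m" "m \<le> q"
    using chain_length_mono[of m p x] chain_length_mono[of q m x] p m q \<epsilon> \<beta>L by force+
  have geodesic: "?t k - ?t i \<le> dist (x i) (x k) + e" if "i \<le> k" "k \<le> n" for i k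
  proof -
    have "dist (x 0) (x n) \<le> dist (x 0) (x i) + dist (x i) (x k) + dist (x k) (x n)"
      using dist_triangle[of "x 0" "x n" "x i"] dist_triangle[of "x i" "x n" "x k"] by linarith
    moreover have "dist (x 0) (x i) \<le> ?t i" "dist (x k) (x n) \<le> L - ?t k"
      using dist_le_chain_length_diff[of 0 i x] dist_le_chain_length_diff[of k n x] that L
      by (auto simp: chain_length_def)
    ultimately show ?thesis using straight(1) by linarith
  qed
  define l where "l = ?t q - ?t p"
  define y where "y = (\<lambda>i. x (p + i))"
  have ly: "chain_length y (q - p) = l"
    using order by (simp add: y_def l_def chain_length_shift)
  obtain c where c: "\<And>i. i \<le> q - p \<Longrightarrow> c (chain_length y i) = y i"
    "\<And>u v. u \<in> {0..l} \<Longrightarrow> v \<in> {0..l} \<Longrightarrow> dist (c u) (c v) \<le> \<bar>u - v\<bar>"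
    using polygon_lipschitz[of "q - p" y] unfolding ly by blast
  have cx: "c (?t i - ?t p) = x i" if "p \<le> i" "i \<le> q" for i
    using c(1)[of "i - p"] that by (simp add: y_def chain_length_shift)
  have l: "L / 2 - \<epsilon> \<le> l" "l \<le> L / 2 + \<epsilon>" "0 < l" using p q \<epsilon> \<beta>L by (auto simp: l_def)
  define s where "s u = c (l * u)" for u
  \<comment> \<open>The enlargement of the radius must be small compared with \<open>h\<close>, so it is proportional to \<open>\<beta>\<close>.\<close>
  define r where "r = L / 4 + \<beta> * L / 32"
  define h where "h = \<beta> * L / 4"
  have s0: "s 0 = x p" and s1: "s 1 = x q"
    using cx[of p] cx[of q] order by (auto simp: s_def l_def)
  have in_image: "x i \<in> path_image s" if "p \<le> i" "i \<le> q" for i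
  proof -
    have "0 \<le> ?t i - ?t p" "?t i - ?t p \<le> l"
      using chain_length_mono[OF that(1), of x] chain_length_mono[OF that(2), of x] by (auto simp: l_def)
    then have "(?t i - ?t p) / l \<in> {0..1}" using l(3) by simp
    moreover have "s ((?t i - ?t p) / l) = x i" using cx[OF that] l(3) by (simp add: s_def)
    ultimately show ?thesis unfolding path_image_def by (metis image_eqI)
  qed
  have mem: "l * u \<in> {0..l}" if "u \<in> {0..1}" for u
    using that l(3) by (simp add: mult_left_le)
  have D: "L / 2 - \<epsilon> - e \<le> dist (x p) (x q)"
    using geodesic[of p q] order q l(1) by (simp add: l_def)
  have Dpos: "0 < dist (x p) (x q)" using D \<epsilon> straight \<beta>L by linarith
  have "\<exists>z\<in>X \<inter> ball (x m) r. h < infdist z (path_image s)"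
  proof (rule ccontr)
    assume *: "\<not> ?thesis"
    have "beta' X (x m) r \<le> ereal ((l - dist (s 0) (s 1) + h) / dist (s 0) (s 1))"
    proof (rule beta'_le)
      show "dist (s u) (s v) \<le> l * \<bar>u - v\<bar>" if "u \<in> {0..1}" "v \<in> {0..1}" for u v
        using c(2)[OF mem mem, OF that] l(3) by (simp add: s_def abs_mult flip: right_diff_distrib)
      show "path_image s \<subseteq> ball (x m) r"
      proof
        fix z assume "z \<in> path_image s"
        then obtain u where u: "u \<in> {0..1}" "z = c (l * u)" by (auto simp: path_image_def s_def)
        have tm: "?t m - ?t p \<in> {0..l}"
          using chain_length_mono[OF order(1), of x] chain_length_mono[OF order(2), of x] by (auto simp: l_def)
        have "dist (x m) z \<le> \<bar>?t m - ?t p - l * u\<bar>"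
          using c(2)[OF tm mem[OF u(1)]] cx[of m] order u(2) by simp
        also have "\<dots> \<le> max (?t m - ?t p) (?t q - ?t m)"
          using mem[OF u(1)] by (auto simp: l_def)
        also have "\<dots> < r" using p m q \<epsilon> \<beta>L by (auto simp: r_def)
        finally show "z \<in> ball (x m) r" by simp
      qed
      show "infdist z (path_image s) \<le> h" if "z \<in> X \<inter> ball (x m) r" for z
        using * that by force
      show "s 0 \<noteq> s 1" using Dpos by (auto simp: s0 s1)
      show "x m \<in> X" using x m by (simp add: chain_def)
      show "0 < r" using L \<beta>L by (simp add: r_def)
    qed
    moreover have "ereal \<beta> < beta' X (x m) r"
    proof -
      have "x m \<in> X" "r \<in> {0<..<r0}" using x m L \<beta>L by (auto simp: chain_def r_def)
      then show ?thesis using beta by blast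
    qed
    ultimately have "\<beta> < (l - dist (x p) (x q) + h) / dist (x p) (x q)"
      using s0 s1 by (metis ereal_less(2) less_ereal.simps(1) order_less_le_trans)
    then have "\<beta> * dist (x p) (x q) < l - dist (x p) (x q) + h"
      using Dpos by (simp add: pos_less_divide_eq)
    also have "\<dots> \<le> e + h"
      using geodesic[of p q] order q by (simp add: l_def)
    also have "\<dots> \<le> 15 / 32 * (\<beta> * L)"
      using straight \<beta>L unfolding h_def by linarith
    also have "\<dots> = \<beta> * (15 * L / 32)" by simp
    finally have "dist (x p) (x q) < 15 * L / 32" using \<beta> by simp
    then show False using D \<epsilon> straight \<beta>L by linarith
  qed
  then obtain z where z: "z \<in> X" "dist (x m) z < r" "h < infdist z (path_image s)" by auto
  have far: "h < dist z (x i)" if "p \<le> i" "i \<le> q" for i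
    using infdist_le[OF in_image[OF that], of z] z(3) by linarith
  have "\<beta> * L / 16 \<le> dist z (x i)" if "i \<le> n" for i
  proof (rule ccontr)
    assume *: "\<not> ?thesis"
    have xm: "dist (x i) (x m) < r + \<beta> * L / 16"
      using * z(2) dist_triangle[of "x i" "x m" z] by (simp add: dist_commute)
    consider "i < p" | "p \<le> i" "i \<le> q" | "q < i" by linarith
    then show False
    proof cases
      case 1
      have "dist (x i) (x p) \<le> ?t p - ?t i" using dist_le_chain_length_diff[of i p x] 1 by simp
      also have "\<dots> \<le> \<beta> * L / 8"
        using geodesic[of i m] 1 order m p xm straight \<epsilon> unfolding r_def by linarith
      finally show False
        using far[of p] order * dist_triangle[of z "x p" "x i"] \<beta>L by (simp add: h_def)
    next
      case 2
      then show False using far[of i] * \<beta>L by (simp add: h_def)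
    next
      case 3
      have "dist (x i) (x q) \<le> ?t i - ?t q"
        using dist_le_chain_length_diff[of q i x] 3 by (simp add: dist_commute)
      also have "\<dots> \<le> \<beta> * L / 8"
        using geodesic[of m i] 3 order m q xm straight \<epsilon> that dist_commute[of "x m" "x i"]
          unfolding r_def by linarith
      finally show False
        using far[of q] order * dist_triangle[of z "x q" "x i"] \<beta>L by (simp add: h_def)
    qed
  qed
  moreover have "dist z (x m) \<le> L / 3"
    using z(2) \<beta>L by (simp add: r_def dist_commute)
  ultimately show ?thesis using that m z(1) by blast
qed

section \<open>Gaining length along a nearly straight chain\<close>

text \<open>
The chain goes from the sphere of radius \<open>w\<close> around \<open>a\<close> to the sphere of radius \<open>w + R\<close>
with small excess, up to one step at each end. The new continuum stays away from both spheres by \<open>R / 20\<close>, which separates it from everything found for other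
values of \<open>w\<close>, and from the chain by \<open>5 * P\<close>, which separates it from continua within distance \<open>P\<close> of the chain.
\<close>

lemma extra_piece_near_straight_chain:
  fixes X :: "linf set" and a :: linf
  assumes beta: "\<forall>x\<in>X. \<forall>r\<in>{0<..<r0}. ereal \<beta> < beta' X x r"
    and X: "compact X" "connected X" and \<beta>: "0 < \<beta>" "\<beta> \<le> 1"
    and y: "chain \<epsilon> X y n"
    and start: "w - \<epsilon> \<le> dist a (y 0)" "dist a (y 0) \<le> w"
    and finish: "w + R - \<epsilon> \<le> dist a (y n)" "dist a (y n) \<le> w + R"
    and straight: "chain_length y n - (dist a (y n) - dist a (y 0)) \<le> \<beta> * R / 250"
    and size: "0 < \<epsilon>" "1000000 * \<epsilon> \<le> \<beta> * P" "100 * P \<le> \<beta> * R" "2 * R \<le> r0"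
    and wide: "p \<in> X" "p' \<in> X" "2 * P \<le> dist p p'"
  obtains Q z q m where "compact Q" "connected Q" "Q \<subseteq> X" "z \<in> Q" "q \<in> Q" "P \<le> dist z q"
    "\<And>v. v \<in> Q \<Longrightarrow> w + R / 20 \<le> dist a v \<and> dist a v \<le> w + R - R / 20"
    "m \<le> n" "\<And>v. v \<in> Q \<Longrightarrow> dist v (y m) \<le> R / 2"
    "\<And>v i. v \<in> Q \<Longrightarrow> i \<le> n \<Longrightarrow> 5 * P \<le> dist v (y i)"
proof -
  define L where "L = chain_length y n"
  have "0 < \<beta> * P" using size by linarith
  then have "0 < P" using \<beta> by (simp add: zero_less_mult_iff)
  then have "0 < \<beta> * R" using size by linarith
  then have "0 < R" using \<beta> by (simp add: zero_less_mult_iff)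
  have \<beta>PR: "\<beta> * P \<le> P" "\<beta> * R \<le> R" "\<beta> * \<epsilon> \<le> \<epsilon>"
    using \<beta> size \<open>0 < P\<close> \<open>0 < R\<close> by simp_all
  have lip: "\<bar>dist a u - dist a v\<bar> \<le> dist u v" for u v
    using dist_triangle[of a u v] dist_triangle[of a v u] by (simp add: dist_commute)
  have "dist (y 0) (y n) \<le> L"
    using dist_le_chain_length_diff[of 0 n y] by (simp add: L_def chain_length_def)
  then have "R - \<epsilon> \<le> L" using lip[of "y 0" "y n"] start finish by linarith
  then have "\<beta> * (R - \<epsilon>) \<le> \<beta> * L" using \<beta> by (intro mult_left_mono) auto
  then have \<beta>L: "\<beta> * R - \<epsilon> \<le> \<beta> * L" using \<beta>PR(3) by (simp add: right_diff_distrib)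
  have L: "L \<le> R + \<epsilon> + \<beta> * R / 250" using straight start finish by (simp add: L_def)
  have pre: "0 < L" "L < r0" "L \<le> dist (y 0) (y n) + \<beta> * R / 250" "\<beta> * R / 250 \<le> \<beta> * L / 64"
      "0 \<le> \<epsilon>" "\<epsilon> \<le> \<beta> * L / 64"
    using straight lip[of "y 0" "y n"] \<beta>L L \<beta>PR size \<open>0 < R\<close> \<open>R - \<epsilon> \<le> L\<close> unfolding L_def by linarith+
  obtain m z where m: "m \<le> n" "z \<in> X" "dist z (y m) \<le> L / 3"
    "L / 2 \<le> chain_length y m" "chain_length y m \<le> L / 2 + \<epsilon>"
    "\<And>i. i \<le> n \<Longrightarrow> \<beta> * L / 16 \<le> dist z (y i)"
    by (rule far_point_near_chain[OF beta y \<beta> L_def pre]) blast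
  have "P \<le> dist z p \<or> P \<le> dist z p'"
    using wide(3) dist_triangle[of p p' z] by (simp add: dist_commute) linarith
  then obtain p'' where p'': "p'' \<in> X" "P \<le> dist z p''" using wide by blast
  have "continuous_on X (\<lambda>v. dist z v - P)" by (intro continuous_intros)
  then obtain Q q where Q: "compact Q" "connected Q" "Q \<subseteq> X" "z \<in> Q"
    "\<And>v. v \<in> Q \<Longrightarrow> dist z v - P \<le> 0" "q \<in> Q" "dist z q - P = 0"
    by (rule subcontinuum_reaching_level[OF X _ m(2) _ p''(1)]) (use p''(2) \<open>0 < P\<close> in auto)
  have fm: "dist a (y m) \<le> w + L / 2 + \<epsilon>" "w + R - \<epsilon> - L / 2 \<le> dist a (y m)"
  proof -
    have "dist (y 0) (y m) \<le> chain_length y m"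
      using dist_le_chain_length_diff[of 0 m y] by (simp add: chain_length_def)
    then show "dist a (y m) \<le> w + L / 2 + \<epsilon>" using lip[of "y 0" "y m"] start m(5) by linarith
    have "dist (y m) (y n) \<le> L - chain_length y m"
      using dist_le_chain_length_diff[OF m(1), of y] by (simp add: L_def)
    then show "w + R - \<epsilon> - L / 2 \<le> dist a (y m)" using lip[of "y m" "y n"] finish m(4) by linarith
  qed
  show ?thesis
  proof (rule that[OF Q(1-4,6)])
    show "P \<le> dist z q" using Q(7) by simp
    fix v assume v: "v \<in> Q"
    have vm: "dist v (y m) \<le> P + L / 3"
      using Q(5)[OF v] m(3) dist_triangle[of v "y m" z] by (simp add: dist_commute)
    then show "dist v (y m) \<le> R / 2" using L \<beta>PR size \<open>0 < R\<close> by linarith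
    show "w + R / 20 \<le> dist a v \<and> dist a v \<le> w + R - R / 20"
      using vm lip[of v "y m"] fm L \<beta>PR size \<open>0 < R\<close> by linarith
    show "5 * P \<le> dist v (y i)" if "i \<le> n" for i
      using m(6)[OF that] Q(5)[OF v] dist_triangle[of z "y i" v] \<beta>L \<beta>PR size by linarith
  qed (rule m(1))
qed

lemma packing_mono: "packing \<theta> m \<gamma> \<F> \<Longrightarrow> m \<le> m' \<Longrightarrow> packing \<theta> m' \<gamma> \<F>"
  unfolding packing_def by (fastforce split: prod.splits)

text \<open>
Spheres around \<open>a\<close> with radii in multiples of \<open>R\<close> cut the chain into \<open>N\<close> blocks, and each
block is crossed by \<open>k\<close> slabs of period \<open>P\<close>. The periods divide exactly: a remainder of one slab per block would
cost as much as the additional continua gain. The slabs give at least \<open>L - 9 * R\<close>, where \<open>R \<le> \<beta> * L / 1000000\<close>. By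
Markov's inequality at least half of the blocks have excess at most \<open>\<beta> * R / 250\<close>, and each of these
gives an additional continuum of size \<open>P \<ge> \<beta> * R / 101\<close>, hence in total at least \<open>\<beta> * L / 202\<close>.
\<close>

lemma packing_along_chain:
  fixes X :: "linf set" and a :: linf
  assumes beta: "\<forall>x\<in>X. \<forall>r\<in>{0<..<r0}. ereal \<beta> < beta' X x r"
    and X: "compact X" "connected X" and \<beta>: "0 < \<beta>" "\<beta> \<le> 1"
    and E: "compact E" "connected E" "E \<subseteq> X"
    and x: "chain \<epsilon> E x n" "x 0 = a" "L \<le> dist a (x n)" "chain_length x n \<le> (1 + \<beta> / 1000) * L"
    and L: "0 < L" "L \<le> r0"
    and N: "1000000 \<le> \<beta> * real N" and k: "100 \<le> \<beta> * real k" "\<beta> * real k \<le> 101"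
    and R: "L = real N * R" and P: "R = real k * P" and \<epsilon>: "P = real N * \<epsilon>"
  obtains \<F> where "packing \<epsilon> P (3 * \<epsilon>) \<F>" "carrier \<F> \<subseteq> X"
    "\<And>v. v \<in> carrier \<F> \<Longrightarrow> \<exists>e\<in>E. dist v e \<le> R / 2"
    "(1 + \<beta> / 2000) * L \<le> sum snd \<F>"
proof -
  define f where "f = dist a"
  have lip: "\<bar>f u - f v\<bar> \<le> dist u v" for u v
    using dist_triangle[of a u v] dist_triangle[of a v u] by (simp add: f_def dist_commute)
  then have lip1: "1-lipschitz_on UNIV f" by (auto simp: lipschitz_on_def dist_real_def)
  have Nk: "0 < real N" "0 < real k" using N k \<beta> by (auto intro!: Nat.gr0I)
  have pos: "0 < R" "0 < P" "0 < \<epsilon>"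
  proof -
    show "0 < R" using L R Nk by (simp add: zero_less_mult_iff)
    then show "0 < P" using P Nk by (simp add: zero_less_mult_iff)
    then show "0 < \<epsilon>" using \<epsilon> Nk by (simp add: zero_less_mult_iff)
  qed
  have sizes: "1000000 * \<epsilon> \<le> \<beta> * P" "100 * P \<le> \<beta> * R" "1000000 * R \<le> \<beta> * L" "\<beta> * R \<le> 101 * P"
    using mult_right_mono[OF N, of \<epsilon>] mult_right_mono[OF k(1), of P] mult_right_mono[OF N, of R]
      mult_right_mono[OF k(2), of P] pos by (auto simp: R P \<epsilon> mult.assoc)
  have \<beta>le: "\<beta> * P \<le> P" "\<beta> * R \<le> R" "\<beta> * L \<le> L"
    using \<beta> pos L by simp_all
  \<comment> \<open>Taking the last index below a level makes block \<open>j\<close>, from \<open>idx j\<close> to \<open>idx (Suc j)\<close>, start below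
     level \<open>j R\<close> and end less than one step below level \<open>(j + 1) R\<close>, hence above the topmost slab of the block.\<close>
  define idx where "idx j = Max {i. i \<le> n \<and> f (x i) \<le> real j * R}" for j
  have idx: "idx j \<le> n" "f (x (idx j)) \<le> real j * R"
    and idx_max: "\<And>i. i \<le> n \<Longrightarrow> f (x i) \<le> real j * R \<Longrightarrow> i \<le> idx j" for j
  proof -
    let ?A = "{i. i \<le> n \<and> f (x i) \<le> real j * R}"
    have "finite ?A" by simp
    moreover have "0 \<in> ?A" using x(2) pos by (simp add: f_def)
    ultimately have "idx j \<in> ?A" unfolding idx_def by (metis Max_in empty_iff)
    then show "idx j \<le> n" "f (x (idx j)) \<le> real j * R" by auto
    show "i \<le> idx j" if "i \<le> n" "f (x i) \<le> real j * R" for i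
      unfolding idx_def using that by (intro Max_ge) auto
  qed
  have idx_mono: "idx j \<le> idx (Suc j)" for j
    by (rule idx_max) (use idx[of j] pos in \<open>auto simp: algebra_simps\<close>)
  have idx_ge: "real j * R - \<epsilon> \<le> f (x (idx j))" if "j \<le> N" for j
  proof (cases "idx j = n")
    case True
    have "real j * R \<le> real N * R" using that pos by (intro mult_right_mono) auto
    then show ?thesis using x(3) R pos unfolding True f_def by linarith
  next
    case False
    then have "Suc (idx j) \<le> n" using idx(1)[of j] by simp
    then have "real j * R < f (x (Suc (idx j)))"
      using idx_max[of "Suc (idx j)" j] by force
    moreover have "dist (x (idx j)) (x (Suc (idx j))) \<le> \<epsilon>"
      using x(1) \<open>Suc (idx j) \<le> n\<close> by (simp add: chain_def)
    ultimately show ?thesis using lip[of "x (idx j)" "x (Suc (idx j))"] by linarith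
  qed
  define y where "y j = (\<lambda>i. x (idx j + i))" for j
  define len where "len j = idx (Suc j) - idx j" for j
  have y_end: "y j 0 = x (idx j)" "y j (len j) = x (idx (Suc j))" for j
    using idx_mono[of j] by (simp_all add: y_def len_def)
  have y_chain: "chain \<epsilon> E (y j) (len j)" for j
    using x(1) idx(1)[of "Suc j"] idx_mono[of j] unfolding chain_def y_def len_def by auto
  have y_length: "chain_length (y j) (len j) = chain_length x (idx (Suc j)) - chain_length x (idx j)" for j
    using idx_mono[of j] chain_length_shift[of x "idx j" "len j"] by (simp add: y_def len_def)

  have "\<exists>\<F>. packing \<epsilon> P (3 * \<epsilon>) \<F> \<and> carrier \<F> \<subseteq> E \<and> P - 9 * \<epsilon> \<le> sum snd \<F> \<and>
      (\<forall>v\<in>carrier \<F>. real q * P \<le> f v \<and> f v \<le> real q * P + P - 3 * \<epsilon> \<and>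
        infdist v (y (q div k) ` {..len (q div k)}) \<le> P)" if "q < N * k" for q
  proof -
    define j where "j = q div k"
    have "real (j * k) \<le> real q" "real q + 1 \<le> real (Suc j * k)" "j < N"
    proof -
      show "real (j * k) \<le> real q" unfolding j_def of_nat_le_iff by (rule div_times_less_eq_dividend)
      have "q < Suc j * k" using dividend_less_div_times[of k q] Nk by (simp add: j_def add.commute)
      then show "real q + 1 \<le> real (Suc j * k)" by linarith
      show "j < N" using that by (simp add: j_def less_mult_imp_div_less)
    qed
    then have bounds: "real j * R \<le> real q * P" "real q * P + P \<le> real (Suc j) * R"
      using mult_right_mono[of "real (j * k)" "real q" P] mult_right_mono[of "real q + 1" "real (Suc j * k)" P] pos
      by (auto simp: P algebra_simps)
    have slab: "f (y j 0) \<le> real q * P" "real q * P + P - 3 * \<epsilon> \<le> f (y j (len j))"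
      "real q * P < real q * P + P - 3 * \<epsilon>" "0 < 3 * \<epsilon>" "0 < \<epsilon>"
      "\<epsilon> \<le> real q * P + P - 3 * \<epsilon> - real q * P" "0 \<le> \<epsilon>"
      using idx(2)[of j] idx_ge[of "Suc j"] \<open>j < N\<close> bounds pos sizes \<beta>le unfolding y_end by linarith+
    obtain \<F> where F: "packing \<epsilon> (real q * P + P - 3 * \<epsilon> - real q * P) (3 * \<epsilon>) \<F>" "carrier \<F> \<subseteq> E"
      "\<And>v. v \<in> carrier \<F> \<Longrightarrow> real q * P \<le> f v \<and> f v \<le> real q * P + P - 3 * \<epsilon> \<and>
         infdist v (y j ` {..len j}) \<le> real q * P + P - 3 * \<epsilon> - real q * P"
      "real q * P + P - 3 * \<epsilon> - real q * P - \<epsilon> - 3 * \<epsilon> - 2 * \<epsilon> \<le> sum snd \<F>"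
      by (rule packing_near_chain[OF E(1,2) y_chain lip1 slab]) blast
    have "packing \<epsilon> P (3 * \<epsilon>) \<F>"
      using F(1) by (rule packing_mono) (use pos in simp)
    moreover have "infdist v (y j ` {..len j}) \<le> P" if "v \<in> carrier \<F>" for v
      using F(3)[OF that] pos by linarith
    moreover have "P - 9 * \<epsilon> \<le> sum snd \<F>" using F(4) by simp
    ultimately show ?thesis using F(2,3) unfolding j_def by blast
  qed
  then obtain M where M: "\<And>q. q < N * k \<Longrightarrow> packing \<epsilon> P (3 * \<epsilon>) (M q)"
    "\<And>q. q < N * k \<Longrightarrow> carrier (M q) \<subseteq> E" "\<And>q. q < N * k \<Longrightarrow> P - 9 * \<epsilon> \<le> sum snd (M q)"
    "\<And>q v. q < N * k \<Longrightarrow> v \<in> carrier (M q) \<Longrightarrow> real q * P \<le> f v \<and> f v \<le> real q * P + P - 3 * \<epsilon> \<and>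
        infdist v (y (q div k) ` {..len (q div k)}) \<le> P"
    by metis
  define \<M> where "\<M> = (\<Union>q\<in>{..<N * k}. M q)"
  have \<M>: "packing \<epsilon> P (3 * \<epsilon>) \<M> \<and> sum snd \<M> = (\<Sum>q\<in>{..<N * k}. sum snd (M q))"
    unfolding \<M>_def
  proof (rule packing_UN)
    have apart: "3 * \<epsilon> \<le> dist v w" if "q < q'" "q' < N * k" "v \<in> carrier (M q)" "w \<in> carrier (M q')" for q q' v w
    proof -
      have "(real q + 1) * P \<le> real q' * P" using that(1) pos by (intro mult_right_mono) auto
      then have "real q * P + P \<le> real q' * P" by (simp add: algebra_simps)
      moreover have "f v \<le> real q * P + P - 3 * \<epsilon>" "real q' * P \<le> f w"
        using M(4)[of q v] M(4)[of q' w] that by auto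
      ultimately show ?thesis using lip[of v w] by linarith
    qed
    show "3 * \<epsilon> \<le> dist v w" if "q \<in> {..<N * k}" "q' \<in> {..<N * k}" "q \<noteq> q'" "v \<in> carrier (M q)" "w \<in> carrier (M q')"
      for q q' v w
      using that apart[of q q' v w] apart[of q' q w v] by (cases "q < q'") (auto simp: dist_commute)
  qed (use M(1) pos in auto)

  \<comment> \<open>The excesses add up to at most the total excess of the chain, because the block lengths and the
     differences of \<open>f\<close> both telescope.\<close>
  define excess where "excess j = chain_length (y j) (len j) - (f (y j (len j)) - f (y j 0))" for j
  define G where "G = {j. j < N \<and> excess j \<le> \<beta> * R / 250}"
  have "\<exists>Q. (\<exists>z q. compact Q \<and> connected Q \<and> z \<in> Q \<and> q \<in> Q \<and> P \<le> dist z q) \<and> Q \<subseteq> X \<and>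
      (\<forall>v\<in>Q. real j * R + R / 20 \<le> f v \<and> f v \<le> real j * R + R - R / 20 \<and>
        (\<exists>e\<in>E. dist v e \<le> R / 2) \<and> (\<forall>i\<le>len j. 5 * P \<le> dist v (y j i)))" if "j \<in> G" for j
  proof -
    have "j < N" "excess j \<le> \<beta> * R / 250" using that by (auto simp: G_def)
    have step: "real j * R + R = real (Suc j) * R" by (simp add: algebra_simps)
    have pre: "chain \<epsilon> X (y j) (len j)"
      "real j * R - \<epsilon> \<le> dist a (y j 0)" "dist a (y j 0) \<le> real j * R"
      "real j * R + R - \<epsilon> \<le> dist a (y j (len j))" "dist a (y j (len j)) \<le> real j * R + R"
      "chain_length (y j) (len j) - (dist a (y j (len j)) - dist a (y j 0)) \<le> \<beta> * R / 250"
      "0 < \<epsilon>" "1000000 * \<epsilon> \<le> \<beta> * P" "100 * P \<le> \<beta> * R" "2 * R \<le> r0"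
      "a \<in> X" "x n \<in> X" "2 * P \<le> dist a (x n)"
    proof -
      show "chain \<epsilon> X (y j) (len j)" using y_chain[of j] E(3) by (auto simp: chain_def)
      show "real j * R - \<epsilon> \<le> dist a (y j 0)" "dist a (y j 0) \<le> real j * R"
        using idx_ge[of j] idx(2)[of j] \<open>j < N\<close> by (simp_all add: y_end f_def)
      show "real j * R + R - \<epsilon> \<le> dist a (y j (len j))" "dist a (y j (len j)) \<le> real j * R + R"
        unfolding step using idx_ge[of "Suc j"] idx(2)[of "Suc j"] \<open>j < N\<close> by (simp_all add: y_end f_def)
      show "chain_length (y j) (len j) - (dist a (y j (len j)) - dist a (y j 0)) \<le> \<beta> * R / 250"
        using \<open>excess j \<le> \<beta> * R / 250\<close> by (simp add: excess_def f_def)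
      show "a \<in> X" "x n \<in> X" using x(1,2) E(3) by (auto simp: chain_def)
      show "2 * P \<le> dist a (x n)" "2 * R \<le> r0" using x(3) sizes \<beta>le pos L by linarith+
    qed (rule pos sizes)+
    obtain Q z q m where "compact Q" "connected Q" "Q \<subseteq> X" "z \<in> Q" "q \<in> Q" "P \<le> dist z q"
      "\<And>v. v \<in> Q \<Longrightarrow> real j * R + R / 20 \<le> dist a v \<and> dist a v \<le> real j * R + R - R / 20"
      "m \<le> len j" "\<And>v. v \<in> Q \<Longrightarrow> dist v (y j m) \<le> R / 2"
      "\<And>v i. v \<in> Q \<Longrightarrow> i \<le> len j \<Longrightarrow> 5 * P \<le> dist v (y j i)"
      by (rule extra_piece_near_straight_chain[OF beta X \<beta> pre]) blast
    moreover have "y j m \<in> E" using y_chain[of j] \<open>m \<le> len j\<close> by (simp add: chain_def)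
    ultimately show ?thesis unfolding f_def by blast
  qed
  then obtain Q where Q: "\<And>j. j \<in> G \<Longrightarrow> \<exists>z q. compact (Q j) \<and> connected (Q j) \<and> z \<in> Q j \<and> q \<in> Q j \<and> P \<le> dist z q"
    "\<And>j. j \<in> G \<Longrightarrow> Q j \<subseteq> X"
    "\<And>j v. j \<in> G \<Longrightarrow> v \<in> Q j \<Longrightarrow> real j * R + R / 20 \<le> f v \<and> f v \<le> real j * R + R - R / 20 \<and>
        (\<exists>e\<in>E. dist v e \<le> R / 2) \<and> (\<forall>i\<le>len j. 5 * P \<le> dist v (y j i))"
    by metis
  have block_step: "real j * R + R \<le> real j' * R" if "j < j'" for j j' :: nat
  proof -
    have "(real j + 1) * R \<le> real j' * R" using that pos by (intro mult_right_mono) auto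
    then show ?thesis by (simp add: algebra_simps)
  qed
  have "finite G" by (simp add: G_def)
  define \<E> where "\<E> = (\<Union>j\<in>G. {(Q j, P)})"
  have \<E>: "packing \<epsilon> P (3 * \<epsilon>) \<E> \<and> sum snd \<E> = (\<Sum>j\<in>G. sum snd {(Q j, P)})"
    unfolding \<E>_def
  proof (rule packing_UN)
    show "packing \<epsilon> P (3 * \<epsilon>) {(Q j, P)}" if "j \<in> G" for j
      using Q(1)[OF that] sizes \<beta>le pos by (elim exE conjE) (rule packing_single; linarith?)
    have apart: "3 * \<epsilon> \<le> dist v w" if "j \<in> G" "j' \<in> G" "j < j'" "v \<in> Q j" "w \<in> Q j'" for j j' v w
      using Q(3)[OF that(1,4)] Q(3)[OF that(2,5)] block_step[OF that(3)] lip[of v w] sizes \<beta>le pos by linarith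
    show "3 * \<epsilon> \<le> dist v w" if "j \<in> G" "j' \<in> G" "j \<noteq> j'" "v \<in> carrier {(Q j, P)}" "w \<in> carrier {(Q j', P)}"
      for j j' v w
      using that apart[of j j' v w] apart[of j' j w v] by (cases "j < j'") (auto simp: dist_commute)
  qed (use pos \<open>finite G\<close> in auto)

  \<comment> \<open>In the same block the distance from the chain separates the two continua, in different blocks the
     function \<open>f\<close> does.\<close>
  have cross: "3 * \<epsilon> \<le> dist v w" if vw: "v \<in> carrier \<M>" "w \<in> carrier \<E>" for v w
  proof -
    obtain q where q: "q < N * k" "v \<in> carrier (M q)" using vw(1) by (auto simp: \<M>_def)
    obtain j where j: "j \<in> G" "w \<in> Q j" using vw(2) by (auto simp: \<E>_def)
    note Mq = M(4)[OF q] and Qj = Q(3)[OF j]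
    define j' where "j' = q div k"
    have "real (j' * k) \<le> real q" "real q + 1 \<le> real (Suc j' * k)"
    proof -
      show "real (j' * k) \<le> real q" unfolding j'_def of_nat_le_iff by (rule div_times_less_eq_dividend)
      have "q < Suc j' * k" using dividend_less_div_times[of k q] Nk by (simp add: j'_def add.commute)
      then show "real q + 1 \<le> real (Suc j' * k)" by linarith
    qed
    then have bounds: "real j' * R \<le> real q * P" "real q * P + P \<le> real j' * R + R"
      using mult_right_mono[of "real (j' * k)" "real q" P] mult_right_mono[of "real q + 1" "real (Suc j' * k)" P] pos
      by (auto simp: P algebra_simps)
    consider "j' = j" | "j' < j" | "j < j'" by linarith
    then show ?thesis
    proof cases
      case 1
      have "5 * P \<le> infdist w (y j ` {..len j})"
        unfolding infdist_notempty[of "y j ` {..len j}", simplified]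
        by (rule cINF_greatest) (use Qj in auto)
      also have "\<dots> \<le> infdist v (y j ` {..len j}) + dist w v" by (rule infdist_triangle)
      finally show ?thesis using Mq 1 sizes \<beta>le pos by (simp add: j'_def dist_commute)
    next
      case 2
      then show ?thesis using Mq Qj bounds block_step[OF 2] lip[of v w] sizes \<beta>le pos by linarith
    next
      case 3
      then show ?thesis using Mq Qj bounds block_step[OF 3] lip[of v w] sizes \<beta>le pos by linarith
    qed
  qed
  have packs: "packing \<epsilon> P (3 * \<epsilon>) \<M>" "packing \<epsilon> P (3 * \<epsilon>) \<E>" using \<M> \<E> by auto
  have "0 < 3 * \<epsilon>" using pos by simp
  note U = packing_Un[OF packs this cross]

  have "real N / 2 \<le> real (card G)"
  proof -
    define B where "B = {..<N} - G"
    have nonneg: "0 \<le> excess j" for j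
      using dist_le_chain_length_diff[of 0 "len j" "y j"] lip[of "y j 0" "y j (len j)"]
      by (simp add: excess_def chain_length_def)
    have "real (card B) * (\<beta> * R / 250) = (\<Sum>j\<in>B. \<beta> * R / 250)" by simp
    also have "\<dots> \<le> (\<Sum>j\<in>B. excess j)"
      by (rule sum_mono) (auto simp: B_def G_def)
    also have "\<dots> \<le> (\<Sum>j<N. excess j)"
      by (rule sum_mono2) (use nonneg in \<open>auto simp: B_def\<close>)
    also have "\<dots> = (\<Sum>j<N. (chain_length x (idx (Suc j)) - f (x (idx (Suc j)))) - (chain_length x (idx j) - f (x (idx j))))"
      by (rule sum.cong) (auto simp: excess_def y_length y_end)
    also have "\<dots> = (chain_length x (idx N) - f (x (idx N))) - (chain_length x (idx 0) - f (x (idx 0)))"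
      by (rule sum_lessThan_telescope)
    also have "\<dots> \<le> chain_length x n - (L - \<epsilon>)"
      using chain_length_mono[OF idx(1), of x N] idx_ge[of N] idx(2)[of 0] chain_length_nonneg[of x "idx 0"]
      by (simp add: R)
    also have "\<dots> \<le> \<beta> * L / 1000 + \<epsilon>" using x(4) by (simp add: algebra_simps)
    also have "\<dots> \<le> \<beta> * L / 500" using sizes \<beta>le pos by linarith
    also have "\<dots> = real N / 2 * (\<beta> * R / 250)" by (simp add: R)
    finally have "real (card B) \<le> real N / 2" using \<beta> pos by simp
    moreover have "card B = N - card G" "card G \<le> N"
    proof -
      have "G \<subseteq> {..<N}" by (auto simp: G_def)
      then show "card B = N - card G" by (simp add: B_def card_Diff_subset \<open>finite G\<close>)
      show "card G \<le> N" using card_mono[OF _ \<open>G \<subseteq> {..<N}\<close>] by simp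
    qed
    ultimately show ?thesis by linarith
  qed
  then have "real N / 2 * P \<le> real (card G) * P" using pos by (intro mult_right_mono) auto
  then have extra: "real N / 2 * P \<le> sum snd \<E>" using \<E> by simp
  have main: "real (N * k) * (P - 9 * \<epsilon>) \<le> sum snd \<M>"
  proof -
    have "(\<Sum>q\<in>{..<N * k}. P - 9 * \<epsilon>) \<le> (\<Sum>q\<in>{..<N * k}. sum snd (M q))"
      by (rule sum_mono) (use M(3) in auto)
    then show ?thesis using \<M> by simp
  qed
  have "(1 + \<beta> / 2000) * L \<le> sum snd (\<M> \<union> \<E>)"
  proof -
    have "real (N * k) * (P - 9 * \<epsilon>) = L - 9 * R"
      by (simp add: R P \<epsilon> algebra_simps)
    moreover have "\<beta> * L \<le> real N * P * 101"
      using mult_left_mono[OF sizes(4), of "real N"] by (simp add: R algebra_simps)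
    ultimately have "L - 9 * R + \<beta> * L / 202 \<le> sum snd (\<M> \<union> \<E>)"
      using U(2) extra main by linarith
    moreover have "9 * R \<le> \<beta> * L / 1000" using sizes(3) pos by linarith
    moreover have "0 \<le> \<beta> * L" using \<beta> L by simp
    ultimately show ?thesis by (simp add: distrib_right)
  qed
  moreover have "carrier (\<M> \<union> \<E>) \<subseteq> X"
    using M(2) Q(2) E(3) by (fastforce simp: \<M>_def \<E>_def)
  moreover have "\<exists>e\<in>E. dist v e \<le> R / 2" if v: "v \<in> carrier (\<M> \<union> \<E>)" for v
  proof -
    from v consider q where "q < N * k" "v \<in> carrier (M q)" | j where "j \<in> G" "v \<in> Q j"
      by (auto simp: \<M>_def \<E>_def)
    then show ?thesis
    proof cases
      case 1
      then have "v \<in> E" using M(2) by blast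
      then show ?thesis using pos by (intro bexI[of _ v]) auto
    qed (use Q(3) in blast)
  qed
  ultimately show ?thesis using that U(1) by blast
qed

section \<open>The dimension bound\<close>

text \<open>
The two alternatives are a large chain distance from \<open>a\<close> to \<open>b\<close>, where the pieces have size
\<open>\<epsilon>\<close>, and a chain of length at most \<open>(1 + \<beta> / 1000) * L\<close>, where they have sizes between \<open>\<epsilon>\<close> and \<open>P\<close>. Gaps of
\<open>3 * m / N\<close> leave room for the neighbourhoods of radius \<open>l / N\<close> of the pieces, and the loss that they cause
has order \<open>1 / N\<close>, which is small compared with \<open>\<beta>\<close>.
\<close>

lemma subcontinua_gaining_length:
  fixes X :: "linf set"
  assumes beta: "\<forall>x\<in>X. \<forall>r\<in>{0<..<r0}. ereal \<beta> < beta' X x r"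
    and X: "compact X" "connected X" and \<beta>: "0 < \<beta>" "\<beta> \<le> 1"
    and E: "compact E" "connected E" "E \<subseteq> X" "a \<in> E" "b \<in> E" "L \<le> dist a b"
    and L: "0 < L" "L \<le> r0"
    and N: "1000000 \<le> \<beta> * real N" and k: "100 \<le> \<beta> * real k" "\<beta> * real k \<le> 101"
    and R: "L = real N * R" and P: "R = real k * P" and \<epsilon>: "P = real N * \<epsilon>"
  obtains \<F> m where "packing \<epsilon> m (3 * m / real N) \<F>" "\<epsilon> \<le> m" "m \<le> L / 2" "carrier \<F> \<subseteq> X"
    "\<And>v. v \<in> carrier \<F> \<Longrightarrow> \<exists>e\<in>E. dist v e \<le> R / 2"
    "(1 + \<beta> / 2000) * L \<le> sum snd \<F>"
proof -
  have Nk: "1000000 \<le> real N" "100 \<le> real k"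
  proof -
    have "\<beta> * real N \<le> 1 * real N" "\<beta> * real k \<le> 1 * real k" using \<beta> by (intro mult_right_mono; simp)+
    then show "1000000 \<le> real N" "100 \<le> real k" using N k by linarith+
  qed
  have pos: "0 < R" "0 < P" "0 < \<epsilon>"
  proof -
    show "0 < R" using L R Nk by (simp add: zero_less_mult_iff)
    then show "0 < P" using P Nk by (simp add: zero_less_mult_iff)
    then show "0 < \<epsilon>" using \<epsilon> Nk by (simp add: zero_less_mult_iff)
  qed
  have sizes: "1000000 * \<epsilon> \<le> P" "100 * P \<le> R" "1000000 * R \<le> L"
    using mult_right_mono[OF Nk(1), of \<epsilon>] mult_right_mono[OF Nk(2), of P] mult_right_mono[OF Nk(1), of R] pos
    by (auto simp: R P \<epsilon>)
  show ?thesis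
  proof (cases "(1 + \<beta> / 1000) * L \<le> chain_dist \<epsilon> E a b")
    case True
    define \<gamma> where "\<gamma> = 3 * \<epsilon> / real N"
    have \<gamma>: "0 < \<gamma>" "\<gamma> \<le> \<epsilon>" using pos Nk by (auto simp: \<gamma>_def divide_simps)
    obtain \<F> where F: "packing \<epsilon> \<epsilon> \<gamma> \<F>" "carrier \<F> \<subseteq> E"
      "\<epsilon> * (chain_dist \<epsilon> E a b / (\<epsilon> + \<gamma>) - 1) \<le> sum snd \<F>"
      using packing_of_chain_dist[OF E(1,2,4,5) \<gamma>] by blast
    have "(1 + \<beta> / 2000) * L \<le> \<epsilon> * (chain_dist \<epsilon> E a b / (\<epsilon> + \<gamma>) - 1)"
    proof -
      define \<tau> where "\<tau> = 1 / real N"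
      have \<tau>: "0 < \<tau>" "\<tau> \<le> \<beta> / 1000000" using N Nk by (auto simp: \<tau>_def field_simps)
      have "\<epsilon> \<le> \<tau> * L" using sizes pos Nk by (simp add: \<tau>_def R)
      have "((1 + \<beta> / 2000) + \<tau>) * (1 + 3 * \<tau>) \<le> 1 + \<beta> / 1000"
      proof -
        have "\<beta> * \<tau> \<le> \<tau>" "\<tau> * \<tau> \<le> \<tau>" using \<tau> \<beta> by simp_all
        moreover have "((1 + \<beta> / 2000) + \<tau>) * (1 + 3 * \<tau>) =
            1 + \<beta> / 2000 + 4 * \<tau> + 3 / 2000 * (\<beta> * \<tau>) + 3 * (\<tau> * \<tau>)"
          by (simp add: algebra_simps)
        ultimately show ?thesis using \<tau> \<beta> by linarith
      qed
      then have "((1 + \<beta> / 2000) + \<tau>) * (1 + 3 * \<tau>) * L \<le> (1 + \<beta> / 1000) * L"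
        using L by (intro mult_right_mono) auto
      also have "\<dots> \<le> chain_dist \<epsilon> E a b" by (rule True)
      finally have "((1 + \<beta> / 2000) + \<tau>) * L \<le> chain_dist \<epsilon> E a b / (1 + 3 * \<tau>)"
        using \<tau> by (simp add: pos_le_divide_eq mult_ac)
      also have "\<dots> = \<epsilon> * (chain_dist \<epsilon> E a b / (\<epsilon> + \<gamma>))"
      proof -
        have "\<epsilon> + \<gamma> = \<epsilon> * (1 + 3 * \<tau>)" by (simp add: \<gamma>_def \<tau>_def algebra_simps)
        then show ?thesis using pos by simp
      qed
      finally show ?thesis using \<open>\<epsilon> \<le> \<tau> * L\<close> by (simp add: algebra_simps)
    qed
    then have "(1 + \<beta> / 2000) * L \<le> sum snd \<F>" using F(3) by linarith
    moreover have "\<exists>e\<in>E. dist v e \<le> R / 2" if "v \<in> carrier \<F>" for v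
      using that F(2) pos by (intro bexI[of _ v]) auto
    moreover have "carrier \<F> \<subseteq> X" using F(2) E(3) by blast
    moreover have "\<epsilon> \<le> L / 2" using sizes pos by linarith
    ultimately show ?thesis using that[of \<epsilon> \<F>] F(1) by (simp add: \<gamma>_def)
  next
    case False
    let ?S = "{chain_length x n |x n. chain \<epsilon> E x n \<and> x 0 = a \<and> x n = b}"
    have "?S \<noteq> {}" using chain_exists[OF E(2,4,5) pos(3)] by blast
    moreover have "Inf ?S < (1 + \<beta> / 1000) * L" using False by (simp add: chain_dist_def)
    ultimately obtain l where "l \<in> ?S" "l < (1 + \<beta> / 1000) * L" by (rule cInf_lessD[THEN bexE])
    then obtain x n where x: "chain \<epsilon> E x n" "x 0 = a" "x n = b" "chain_length x n \<le> (1 + \<beta> / 1000) * L"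
      by auto
    have "L \<le> dist a (x n)" using E(6) x(3) by simp
    then obtain \<F> where F: "packing \<epsilon> P (3 * \<epsilon>) \<F>" "carrier \<F> \<subseteq> X"
      "\<And>v. v \<in> carrier \<F> \<Longrightarrow> \<exists>e\<in>E. dist v e \<le> R / 2" "(1 + \<beta> / 2000) * L \<le> sum snd \<F>"
      using packing_along_chain[OF beta X \<beta> E(1-3) x(1,2) _ x(4) L N k R P \<epsilon>] by blast
    have "3 * P / real N = 3 * \<epsilon>" using Nk by (simp add: \<epsilon>)
    moreover have "\<epsilon> \<le> P" "P \<le> L / 2" using sizes pos by linarith+
    ultimately show ?thesis using that[of P \<F>] F by simp
  qed
qed

text \<open>
As \<open>M\<close> is polynomial in \<open>1 / \<beta>\<close>, its logarithm is at most \<open>300000 / \<beta>\<close>. This crude bound makes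
\<open>s * ln M\<close> at most \<open>\<beta> / 4000\<close>, about half of \<open>ln (1 + \<beta> / 2000)\<close>.
\<close>

lemma exponent_gain:
  fixes \<beta> s M :: real
  assumes \<beta>: "0 < \<beta>" "\<beta> \<le> 1" and s: "0 \<le> s" "s \<le> \<beta>\<^sup>2 / 1200000000" and M: "1 \<le> M" "M \<le> 10^15 / \<beta>^3"
  shows "1 \<le> (1 + \<beta> / 2000) * (1 / M) powr s"
proof -
  have "ln M \<le> ln ((10^5 / \<beta>)^3)"
    using M \<beta> by (intro ln_mono) (auto simp: power_divide)
  also have "\<dots> = 3 * ln (10^5 / \<beta>)" using \<beta> by (subst ln_realpow) auto
  also have "\<dots> \<le> 3 * (10^5 / \<beta>)" using \<beta> ln_bound[of "10^5 / \<beta>"] by simp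
  finally have "s * ln M \<le> (\<beta>\<^sup>2 / 1200000000) * (3 * (10^5 / \<beta>))"
    using s M \<beta> by (intro mult_mono) auto
  also have "\<dots> = \<beta> / 4000" using \<beta> by (simp add: power2_eq_square)
  also have "\<dots> \<le> \<beta> / 2000 - (\<beta> / 2000)\<^sup>2"
  proof -
    have "\<beta>\<^sup>2 \<le> \<beta>" using \<beta> by (simp add: power2_eq_square)
    then show ?thesis using \<beta> by (simp add: power_divide)
  qed
  also have "\<dots> \<le> ln (1 + \<beta> / 2000)"
    using ln_one_plus_pos_lower_bound[of "\<beta> / 2000"] \<beta> by simp
  finally have "exp (s * ln M) \<le> 1 + \<beta> / 2000" using \<beta> by (simp add: ln_ge_iff)
  then have "M powr s \<le> 1 + \<beta> / 2000" using M by (simp add: powr_def)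
  moreover have "0 < M powr s" using M by simp
  ultimately show ?thesis using M by (simp add: powr_divide)
qed

theorem theorem4:
  shows "\<exists>c0 > (0::real). \<forall>(X :: linf set) (\<beta>::real) (r0::real).
    X \<noteq> {} \<longrightarrow> compact X \<longrightarrow> connected X \<longrightarrow> \<beta> > 0 \<longrightarrow> r0 > 0 \<longrightarrow>
    (\<forall>x\<in>X. \<forall>r\<in>{0<..<r0}. beta' X x r > ereal \<beta>) \<longrightarrow>
    hausdorff_dim X \<ge> ereal (1 + c0 * \<beta>\<^sup>2)"
proof (intro exI[of _ "1 / 10^10 :: real"] conjI allI impI)
  show "0 < (1 / 10^10 :: real)" by simp
  fix X :: "linf set" and \<beta>0 r0 :: real
  assume X: "X \<noteq> {}" "compact X" "connected X" and "\<beta>0 > 0" "r0 > 0"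
    and wiggly: "\<forall>x\<in>X. \<forall>r\<in>{0<..<r0}. beta' X x r > ereal \<beta>0"
  obtain x0 where "x0 \<in> X" using X by blast
  have x0: "ereal \<beta>0 < beta' X x0 (r0 / 2)"
    using wiggly \<open>x0 \<in> X\<close> \<open>r0 > 0\<close> by simp
  have "\<beta>0 < 2"
  proof -
    have "beta' X x0 (r0 / 2) \<le> ereal (2 * (r0 / 2) / (r0 / 2))"
      by (rule beta'_le_of_subset_cball) (use \<open>x0 \<in> X\<close> \<open>r0 > 0\<close> in \<open>auto simp: dist_commute\<close>)
    with x0 have "ereal \<beta>0 < ereal (2 * (r0 / 2) / (r0 / 2))" by (rule less_le_trans)
    then show ?thesis using \<open>r0 > 0\<close> by simp
  qed
  have "\<exists>y\<in>X. y \<noteq> x0"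
  proof (rule ccontr)
    assume *: "\<not> ?thesis"
    have "beta' X x0 (r0 / 2) \<le> ereal (2 * 0 / (r0 / 2))"
    proof (rule beta'_le_of_subset_cball)
      fix z assume "z \<in> X \<inter> ball x0 (r0 / 2)"
      then have "z = x0" using * by blast
      then show "dist z x0 \<le> 0" by simp
    qed (use \<open>x0 \<in> X\<close> \<open>r0 > 0\<close> in simp_all)
    with x0 have "ereal \<beta>0 < ereal (2 * 0 / (r0 / 2))" by (rule less_le_trans)
    then show False using \<open>\<beta>0 > 0\<close> by simp
  qed
  then obtain y0 where "y0 \<in> X" "y0 \<noteq> x0" by blast
  \<comment> \<open>A segment shows that \<open>\<beta>0 < 2\<close>; halving brings the parameter into the range up to \<open>1\<close>.\<close>
  define \<beta> where "\<beta> = \<beta>0 / 2"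
  have \<beta>: "0 < \<beta>" "\<beta> \<le> 1" using \<open>\<beta>0 > 0\<close> \<open>\<beta>0 < 2\<close> by (auto simp: \<beta>_def)
  have beta: "\<forall>x\<in>X. \<forall>r\<in>{0<..<r0}. ereal \<beta> < beta' X x r"
  proof (intro ballI)
    fix x r assume "x \<in> X" "r \<in> {0<..<r0}"
    then have "ereal \<beta>0 < beta' X x r" using wiggly by blast
    moreover have "ereal \<beta> < ereal \<beta>0" using \<open>\<beta>0 > 0\<close> by (simp add: \<beta>_def)
    ultimately show "ereal \<beta> < beta' X x r" by (rule less_trans[rotated])
  qed
  define N k where "N = nat \<lceil>1000000 / \<beta>\<rceil>" and "k = nat \<lceil>100 / \<beta>\<rceil>"
  have N0: "1000000 / \<beta> \<le> real N" "real N \<le> 1000000 / \<beta> + 1"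
    and k0: "100 / \<beta> \<le> real k" "real k \<le> 100 / \<beta> + 1"
    using \<beta> by (auto simp: N_def k_def of_nat_ceiling intro!: of_int_ceiling_le_add_one)
  have N: "1000000 \<le> \<beta> * real N" "\<beta> * real N \<le> 1000001"
    and k: "100 \<le> \<beta> * real k" "\<beta> * real k \<le> 101"
    using N0 k0 \<beta> by (auto simp: field_simps)
  have Nk: "1 \<le> real N" "1 \<le> real k"
  proof -
    have "\<beta> * real N \<le> 1 * real N" "\<beta> * real k \<le> 1 * real k" using \<beta> by (intro mult_right_mono; simp)+
    then show "1 \<le> real N" "1 \<le> real k" using N k by linarith+
  qed
  \<comment> \<open>The ratio of \<open>L\<close> to the smallest size of a child.\<close>
  define M where "M = real N * real k * real N"
  have M: "1 \<le> M" "M \<le> 10^15 / \<beta>^3"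
  proof -
    show "1 \<le> M" using Nk by (simp add: M_def mult_ge1_I)
    have "(\<beta> * real N) * (\<beta> * real k) * (\<beta> * real N) \<le> 1000001 * 101 * 1000001"
      using N k \<beta> by (intro mult_mono) auto
    then have "M * \<beta>^3 \<le> 10^15" by (simp add: M_def power3_eq_cube mult_ac)
    then show "M \<le> 10^15 / \<beta>^3" using \<beta> by (simp add: pos_le_divide_eq)
  qed
  define s where "s = 1 / 10^10 * \<beta>0\<^sup>2"
  have s: "0 \<le> s" "s \<le> \<beta>\<^sup>2 / 1200000000"
    by (auto simp: s_def \<beta>_def power_divide)
  define t where "t = 1 + s"
  define L0 where "L0 = min (dist x0 y0) r0"
  have L0: "0 < L0" using \<open>y0 \<noteq> x0\<close> \<open>r0 > 0\<close> by (simp add: L0_def)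
  define node where "node = (\<lambda>(F :: linf set, l). compact F \<and> connected F \<and> F \<subseteq> X \<and>
      0 < l \<and> l \<le> r0 \<and> (\<exists>a\<in>F. \<exists>b\<in>F. l \<le> dist a b))"
  define region where "region = (\<lambda>(F :: linf set, l). {y \<in> X. \<exists>e\<in>F. dist y e \<le> l / real N})"
  have "node (X, L0)"
  proof -
    have "L0 \<le> dist x0 y0" "L0 \<le> r0" by (simp_all add: L0_def)
    then show ?thesis using X L0 \<open>x0 \<in> X\<close> \<open>y0 \<in> X\<close> unfolding node_def by blast
  qed
  have branching: "\<exists>C. finite C
      \<and> (\<forall>c\<in>C. node c \<and> snd c \<le> snd n / 2 \<and> region c \<subseteq> region n)
      \<and> (\<forall>a\<in>C. \<forall>b\<in>C. a \<noteq> b \<longrightarrow> (\<forall>y\<in>region a. \<forall>z\<in>region b. 1 / (real N * M) * snd n \<le> dist y z))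
      \<and> snd n powr t \<le> (\<Sum>c\<in>C. snd c powr t)" if n: "node n" for n
  proof -
    obtain E L where EL: "n = (E, L)" by (cases n)
    obtain a b where E: "compact E" "connected E" "E \<subseteq> X" "a \<in> E" "b \<in> E" "L \<le> dist a b"
      and L: "0 < L" "L \<le> r0"
      using n by (auto simp: EL node_def)
    define R P \<epsilon> where "R = L / real N" and "P = R / real k" and "\<epsilon> = P / real N"
    have scales: "L = real N * R" "R = real k * P" "P = real N * \<epsilon>"
      using Nk by (auto simp: R_def P_def \<epsilon>_def)
    have \<epsilon>: "\<epsilon> = L / M" by (simp add: R_def P_def \<epsilon>_def M_def)
    then have "0 < \<epsilon>" using L M by simp
    obtain C m where C: "packing \<epsilon> m (3 * m / real N) C" "\<epsilon> \<le> m" "m \<le> L / 2" "carrier C \<subseteq> X"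
      "\<And>v. v \<in> carrier C \<Longrightarrow> \<exists>e\<in>E. dist v e \<le> R / 2" "(1 + \<beta> / 2000) * L \<le> sum snd C"
      by (rule subcontinua_gaining_length[OF beta X(2,3) \<beta> E L N(1) k scales]) blast
    have "finite C" using C(1) by (simp add: packing_def)
    have inC: "compact F" "connected F" "\<epsilon> \<le> l" "l \<le> m" "\<exists>y\<in>F. \<exists>z\<in>F. l \<le> dist y z" "F \<subseteq> carrier C"
      if "(F, l) \<in> C" for F l
      using C(1) that by (auto simp: packing_def carrier_def)
    have "node c \<and> snd c \<le> snd n / 2 \<and> region c \<subseteq> region n" if c: "c \<in> C" for c
    proof -
      obtain F l where Fl: "c = (F, l)" by (cases c)
      note F = inC[OF c[unfolded Fl]]
      have "region c \<subseteq> region n"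
      proof
        fix y assume "y \<in> region c"
        then obtain e where e: "y \<in> X" "e \<in> F" "dist y e \<le> l / real N" by (auto simp: region_def Fl)
        then obtain e' where e': "e' \<in> E" "dist e e' \<le> R / 2" using C(5) F(6) by blast
        have "l / real N \<le> L / 2 / real N" using F(4) C(3) by (intro divide_right_mono) auto
        then have "dist y e' \<le> L / real N"
          using dist_triangle[of y e' e] e(3) e'(2) by (simp add: R_def)
        then show "y \<in> region n" using e(1) e'(1) by (auto simp: region_def EL)
      qed
      moreover have "F \<subseteq> X" using F(6) C(4) by blast
      ultimately show ?thesis
        using F C(3) L \<open>0 < \<epsilon>\<close> by (auto simp: node_def Fl EL)
    qed
    moreover have "1 / (real N * M) * snd n \<le> dist y z"
      if yz: "c \<in> C" "d \<in> C" "c \<noteq> d" "y \<in> region c" "z \<in> region d" for c d y z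
    proof -
      obtain F l where Fl: "c = (F, l)" by (cases c)
      obtain F' l' where Fl': "d = (F', l')" by (cases d)
      obtain e where e: "e \<in> F" "dist y e \<le> l / real N" using yz(4) by (auto simp: region_def Fl)
      obtain e' where e': "e' \<in> F'" "dist z e' \<le> l' / real N" using yz(5) by (auto simp: region_def Fl')
      have "3 * m / real N \<le> dist e e'"
        using C(1) yz(1-3) e(1) e'(1) unfolding packing_def Fl Fl' by fastforce
      moreover have "l / real N \<le> m / real N" "l' / real N \<le> m / real N" "\<epsilon> / real N \<le> m / real N"
        using inC(4)[of F l] inC(4)[of F' l'] yz(1,2) C(2) by (auto simp: Fl Fl' divide_right_mono)
      moreover have "dist e e' \<le> dist y e + dist y z + dist z e'"
        using dist_triangle[of e e' y] dist_triangle[of y e' z] by (simp add: dist_commute)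
      ultimately have "\<epsilon> / real N \<le> dist y z" using e(2) e'(2) by linarith
      then show ?thesis by (simp add: \<epsilon> EL mult.commute)
    qed
    moreover have "snd n powr t \<le> (\<Sum>c\<in>C. snd c powr t)"
    proof -
      have "L powr t = L * L powr s * 1" using L by (simp add: t_def powr_add)
      also have "\<dots> \<le> L * L powr s * ((1 + \<beta> / 2000) * (1 / M) powr s)"
        using exponent_gain[OF \<beta> s M] L by (intro mult_left_mono) auto
      also have "\<dots> = \<epsilon> powr s * ((1 + \<beta> / 2000) * L)"
        using L M by (simp add: \<epsilon> powr_divide)
      also have "\<dots> \<le> \<epsilon> powr s * sum snd C" using C(6) by (intro mult_left_mono) auto
      also have "\<dots> = (\<Sum>c\<in>C. \<epsilon> powr s * snd c)" by (simp add: sum_distrib_left)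
      also have "\<dots> \<le> (\<Sum>c\<in>C. snd c powr t)"
      proof (rule sum_mono)
        fix c assume "c \<in> C"
        then have "\<epsilon> \<le> snd c" using inC(3)[of "fst c" "snd c"] by simp
        then have "\<epsilon> powr s * snd c \<le> snd c powr s * snd c"
          using s \<open>0 < \<epsilon>\<close> by (intro mult_right_mono powr_mono2) auto
        also have "\<dots> = snd c powr t" using \<open>\<epsilon> \<le> snd c\<close> \<open>0 < \<epsilon>\<close> by (simp add: t_def powr_add mult.commute)
        finally show "\<epsilon> powr s * snd c \<le> snd c powr t" .
      qed
      finally show ?thesis by (simp add: EL)
    qed
    ultimately show ?thesis using \<open>finite C\<close> by (intro exI[of _ C]) simp
  qed
  have "ereal t \<le> hausdorff_dim X"
  proof (rule hausdorff_dim_ge_of_cover_sums[OF X(2)])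
    show "0 < t" using s by (simp add: t_def)
    have NM: "0 < real N * M" "1 \<le> real N * M" using Nk M by (simp_all add: mult_ge1_I)
    have \<sigma>: "0 < 1 / (real N * M)" "1 / (real N * M) \<le> 1"
      using divide_pos_pos[OF zero_less_one NM(1)] NM(2) divide_le_eq_1_pos[OF NM(1), of 1] by blast+
    have "0 < 1 / (real N * M) * L0" by (rule mult_pos_pos[OF \<sigma>(1) L0])
    then show "0 < (1 / (real N * M) * L0) powr t" by (metis less_irrefl powr_gt_zero)
    fix I :: "nat set" and U and d :: "nat \<Rightarrow> real"
    assume I: "finite I" "X \<subseteq> (\<Union>i\<in>I. U i)" and d: "\<And>i. i \<in> I \<Longrightarrow> 0 < d i"
      "\<And>i y z. i \<in> I \<Longrightarrow> y \<in> U i \<Longrightarrow> z \<in> U i \<Longrightarrow> dist y z \<le> d i"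
    have "(1 / (real N * M) * snd (X, L0)) powr t \<le> (\<Sum>i\<in>{i\<in>I. U i \<inter> region (X, L0) \<noteq> {}}. d i powr t)"
    proof (rule cover_sum_ge_of_branching[where node = node and region = region and size = snd and X = X])
      show "0 < t" by fact
      show "0 < 1 / (real N * M)" "1 / (real N * M) \<le> 1" by (fact \<sigma>)+
      show "0 < snd n" if "node n" for n using that by (auto simp: node_def)
      show "region n \<inter> X \<noteq> {}" if n: "node n" for n
      proof -
        obtain F l where Fl: "n = (F, l)" by (cases n)
        obtain a where "a \<in> F" "F \<subseteq> X" "0 < l" using n by (auto simp: node_def Fl)
        then have "a \<in> region n" by (auto simp: region_def Fl intro!: bexI[of _ a])
        then show ?thesis using \<open>a \<in> F\<close> \<open>F \<subseteq> X\<close> by blast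
      qed
    qed (fact branching I d \<open>node (X, L0)\<close>)+
    also have "\<dots> \<le> (\<Sum>i\<in>I. d i powr t)"
      by (rule sum_mono2) (use I in auto)
    finally show "(1 / (real N * M) * L0) powr t \<le> (\<Sum>i\<in>I. d i powr t)" by simp
  qed
  then show "ereal (1 + 1 / 10^10 * \<beta>0\<^sup>2) \<le> hausdorff_dim X"
    by (simp add: t_def s_def)
qed

end
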